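(* There is a polynomial-time 2-approximation algorithm for (the minimization version of) W-MinMaxInd, and there is a polynomial-time 4-approximation algorithm for (the minimization version of) W-MinMaxStar.
   Context: An instance of either problem is a finite simple graph $G=(V,E)$ with node weights $w_v>0$ for $v\in V$ (rational, for computational purposes). There are no node capacity constraints. W-MinMaxInd (minimization version): for an orientation $\Lambda$ of $G$ and $v\in V$, let $k(G,\Lambda,v)$ be the sum of the weights $w_u$ of all nodes $u$ having an edge directed from $u$ to $v$. The task is to find an orientation minimizing $\max_{v\in V}k(G,\Lambda,v)$. W-MinMaxStar (minimization version): a star partitioning $C$ assigns each edge $e\in E$ to one of its two endpoints; for each node $u$ the set of edges assigned to $u$, if non-empty, is a star with internal node $u$ and weight $w_u$. For $v\in V$, $x(G,C,v)$ is the sum of the weights of all stars having an edge incident to $v$. The task is to find a star partitioning minimizing $\max_{v\in V}x(G,C,v)$. An $\alpha$-approximation algorithm outputs on every instance a feasible solution whose objective value is at most $\alpha$ times the optimal value. *)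

theory Defs
  imports
    "HOL-Library.Log_Nat"
    "HOL-Computational_Algebra.Polynomial"
begin

section \<open>Model of computation\<close>

text \<open>
  Deterministic while-programs over binary trees whose leaves are integers written in binary.
  A step that handles some data is charged the number of bits of this data (logarithmic cost),
  and every operation can be carried out by a Turing machine in time polynomial
  in this charge.  Conversely, a Turing machine is simulated with polynomial overhead by a loop
  over its configurations, the tapes being represented as lists.  Hence running in polynomial time
  has its usual meaning.
\<close>

datatype val = Num int | Pair val val

fun vsize :: "val \<Rightarrow> nat" where
  "vsize (Num i) = 1 + floorlog 2 (nat \<bar>i\<bar>)"
| "vsize (Pair a b) = 1 + vsize a + vsize b"

datatype prim = Ident | Const int | First | Second | IsPair | Add | Sub | Mul | Div | Leq

text \<open>Operations applied to arguments of the wrong shape return 0.\<close>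

fun apply_prim :: "prim \<Rightarrow> val \<Rightarrow> val" where
  "apply_prim Ident x = x"
| "apply_prim (Const i) x = Num i"
| "apply_prim First (Pair a b) = a"
| "apply_prim Second (Pair a b) = b"
| "apply_prim IsPair (Pair a b) = Num 1"
| "apply_prim Add (Pair (Num i) (Num j)) = Num (i + j)"
| "apply_prim Sub (Pair (Num i) (Num j)) = Num (i - j)"
| "apply_prim Mul (Pair (Num i) (Num j)) = Num (i * j)"
| "apply_prim Div (Pair (Num i) (Num j)) = Num (i div j)"
| "apply_prim Leq (Pair (Num i) (Num j)) = Num (if i \<le> j then 1 else 0)"
| "apply_prim _ _ = Num 0"

datatype prog =
    Prim prim
  | Seq prog prog
  | Fork prog prog
  | Cond prog prog prog
  | While prog prog

text \<open>
  \<open>run p x y t\<close>: on input \<open>x\<close> the program \<open>p\<close> halts with output \<open>y\<close> after time \<open>t\<close>.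
  \<open>Fork p q\<close> maps \<open>x\<close> to the pair of the results of \<open>p\<close> and \<open>q\<close> on \<open>x\<close>;
  in \<open>Cond\<close> and \<open>While\<close> the value 0 means false.  Copying \<open>x\<close> in \<open>Fork\<close>, \<open>Cond\<close> and \<open>While\<close> is
  accounted for, because a run on \<open>x\<close> takes time at least \<open>vsize x\<close>.
\<close>

inductive run :: "prog \<Rightarrow> val \<Rightarrow> val \<Rightarrow> nat \<Rightarrow> bool" where
  Prim: "run (Prim f) x (apply_prim f x) (vsize x + vsize (apply_prim f x))"
| Seq: "run p x y s \<Longrightarrow> run q y z t \<Longrightarrow> run (Seq p q) x z (s + t + 1)"
| Fork: "run p x y s \<Longrightarrow> run q x z t \<Longrightarrow> run (Fork p q) x (Pair y z) (s + t + 1)"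
| CondTrue: "run b x c r \<Longrightarrow> c \<noteq> Num 0 \<Longrightarrow> run p x y s \<Longrightarrow> run (Cond b p q) x y (r + s + 1)"
| CondFalse: "run b x (Num 0) r \<Longrightarrow> run q x y s \<Longrightarrow> run (Cond b p q) x y (r + s + 1)"
| WhileTrue: "run b x c r \<Longrightarrow> c \<noteq> Num 0 \<Longrightarrow> run p x y s \<Longrightarrow> run (While b p) y z t \<Longrightarrow>
    run (While b p) x z (r + s + t + 1)"
| WhileFalse: "run b x (Num 0) r \<Longrightarrow> run (While b p) x x (r + 1)"

lemma run_deterministic:
  "run p x y t \<Longrightarrow> run p x y' t' \<Longrightarrow> y' = y \<and> t' = t"
proof (induction arbitrary: y' t' rule: run.induct)
  case (Prim f x)
  then show ?case by (auto elim: run.cases)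
next
  case (Seq p x y s q z t)
  from Seq.prems show ?case
    by (cases rule: run.cases) (use Seq.IH in blast)+
next
  case (Fork p x y s q z t)
  from Fork.prems show ?case
    by (cases rule: run.cases) (use Fork.IH in blast)+
next
  case (CondTrue b x c r p y s q)
  from CondTrue.prems show ?case
    by (cases rule: run.cases) (use CondTrue.IH CondTrue.hyps in blast)+
next
  case (CondFalse b x r q y s p)
  from CondFalse.prems show ?case
    by (cases rule: run.cases) (use CondFalse.IH CondFalse.hyps in blast)+
next
  case (WhileTrue b x c r p y s z t)
  from WhileTrue.prems show ?case
    by (cases rule: run.cases) (use WhileTrue.IH WhileTrue.hyps in blast)+
next
  case (WhileFalse b x r p)
  from WhileFalse.prems show ?case
    by (cases rule: run.cases) (use WhileFalse.IH in blast)+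
qed

lemma vsize_le_time: "run p x y t \<Longrightarrow> vsize x \<le> t \<and> vsize y \<le> t"
  by (induction rule: run.induct) auto

definition polynomial_time_on :: "val set \<Rightarrow> prog \<Rightarrow> bool" where
  "polynomial_time_on X p \<longleftrightarrow>
     (\<exists>P :: nat poly. \<forall>x\<in>X. \<exists>y t. run p x y t \<and> t \<le> poly P (vsize x))"


section \<open>Minimization problems and approximation algorithms\<close>

record ('i, 's) min_problem =
  is_instance :: "'i \<Rightarrow> bool"
  feasible :: "'i \<Rightarrow> 's \<Rightarrow> bool"
  objective :: "'i \<Rightarrow> 's \<Rightarrow> rat"
  instance_code :: "'i \<Rightarrow> val \<Rightarrow> bool"
  solution_code :: "'i \<Rightarrow> 's \<Rightarrow> val \<Rightarrow> bool"

text \<open>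
  Only meaningful if the objective takes finitely many values on feasible solutions,
  as it does in the problems below.
\<close>

definition optimal_value :: "('i, 's) min_problem \<Rightarrow> 'i \<Rightarrow> rat" where
  "optimal_value \<Pi> I = Min {objective \<Pi> I S | S. feasible \<Pi> I S}"

definition instance_codes :: "('i, 's) min_problem \<Rightarrow> val set" where
  "instance_codes \<Pi> = {x. \<exists>I. is_instance \<Pi> I \<and> instance_code \<Pi> I x}"

definition approximation_algorithm :: "rat \<Rightarrow> ('i, 's) min_problem \<Rightarrow> prog \<Rightarrow> bool" where
  "approximation_algorithm \<alpha> \<Pi> p \<longleftrightarrow>
     (\<forall>I x. is_instance \<Pi> I \<longrightarrow> instance_code \<Pi> I x \<longrightarrow>
        (\<exists>y t S. run p x y t \<and> solution_code \<Pi> I S y \<and> feasible \<Pi> I S \<and>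
           objective \<Pi> I S \<le> \<alpha> * optimal_value \<Pi> I))"

definition polytime_approximation_algorithm :: "rat \<Rightarrow> ('i, 's) min_problem \<Rightarrow> prog \<Rightarrow> bool" where
  "polytime_approximation_algorithm \<alpha> \<Pi> p \<longleftrightarrow>
     approximation_algorithm \<alpha> \<Pi> p \<and> polynomial_time_on (instance_codes \<Pi>) p"


section \<open>The two problems\<close>

record 'a wgraph =
  verts :: "'a set"
  edges :: "'a set set"
  weight :: "'a \<Rightarrow> rat"

definition weighted_simple_graph :: "'a wgraph \<Rightarrow> bool" where
  "weighted_simple_graph G \<longleftrightarrow> finite (verts G) \<and>
     (\<forall>e\<in>edges G. e \<subseteq> verts G \<and> card e = 2) \<and> (\<forall>v\<in>verts G. 0 < weight G v)"

definition orientation :: "'a wgraph \<Rightarrow> ('a \<times> 'a) set \<Rightarrow> bool" where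
  "orientation G \<Lambda> \<longleftrightarrow> (\<forall>(u, v)\<in>\<Lambda>. {u, v} \<in> edges G) \<and>
     (\<forall>u v. {u, v} \<in> edges G \<longrightarrow> ((u, v) \<in> \<Lambda> \<longleftrightarrow> (v, u) \<notin> \<Lambda>))"

definition in_weight :: "'a wgraph \<Rightarrow> ('a \<times> 'a) set \<Rightarrow> 'a \<Rightarrow> rat" where
  "in_weight G \<Lambda> v = (\<Sum>u\<in>{u \<in> verts G. (u, v) \<in> \<Lambda>}. weight G u)"

text \<open>
  The element 0 inserted below gives a value to the graph without vertices; for all other graphs it
  changes nothing, as the weights are positive.
\<close>

definition max_in_weight :: "'a wgraph \<Rightarrow> ('a \<times> 'a) set \<Rightarrow> rat" where
  "max_in_weight G \<Lambda> = Max (insert 0 (in_weight G \<Lambda> ` verts G))"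

definition star_partitioning :: "'a wgraph \<Rightarrow> ('a set \<Rightarrow> 'a) \<Rightarrow> bool" where
  "star_partitioning G C \<longleftrightarrow> (\<forall>e\<in>edges G. C e \<in> e)"

definition star :: "'a wgraph \<Rightarrow> ('a set \<Rightarrow> 'a) \<Rightarrow> 'a \<Rightarrow> 'a set set" where
  "star G C u = {e \<in> edges G. C e = u}"

definition star_weight :: "'a wgraph \<Rightarrow> ('a set \<Rightarrow> 'a) \<Rightarrow> 'a \<Rightarrow> rat" where
  "star_weight G C v = (\<Sum>u\<in>{u \<in> verts G. \<exists>e\<in>star G C u. v \<in> e}. weight G u)"

definition max_star_weight :: "'a wgraph \<Rightarrow> ('a set \<Rightarrow> 'a) \<Rightarrow> rat" where
  "max_star_weight G C = Max (insert 0 (star_weight G C ` verts G))"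

text \<open>
  For computations vertices are natural numbers.  Finite sets are presented as lists without
  repetition, in an arbitrary order; similarly, each edge is listed once, with its endpoints in
  an arbitrary order.  Rational numbers are fractions in lowest terms with positive denominator.
\<close>

fun list_val :: "val list \<Rightarrow> val" where
  "list_val [] = Num 0"
| "list_val (x # xs) = Pair x (list_val xs)"

definition vertex_val :: "nat \<Rightarrow> val" where
  "vertex_val v = Num (int v)"

definition pair_val :: "nat \<times> nat \<Rightarrow> val" where
  "pair_val = (\<lambda>(u, v). Pair (vertex_val u) (vertex_val v))"

definition rat_val :: "rat \<Rightarrow> val" where
  "rat_val r = (case quotient_of r of (a, b) \<Rightarrow> Pair (Num a) (Num b))"

definition set_listing :: "'a list \<Rightarrow> 'a set \<Rightarrow> bool" where
  "set_listing xs A \<longleftrightarrow> distinct xs \<and> set xs = A"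

definition edge_of :: "'a \<times> 'a \<Rightarrow> 'a set" where
  "edge_of = (\<lambda>(u, v). {u, v})"

definition graph_code :: "nat wgraph \<Rightarrow> val \<Rightarrow> bool" where
  "graph_code G x \<longleftrightarrow>
     (\<exists>vs es. set_listing vs (verts G) \<and> set_listing (map edge_of es) (edges G) \<and>
        x = Pair (list_val (map (\<lambda>v. Pair (vertex_val v) (rat_val (weight G v))) vs))
                 (list_val (map pair_val es)))"

definition orientation_code :: "nat wgraph \<Rightarrow> (nat \<times> nat) set \<Rightarrow> val \<Rightarrow> bool" where
  "orientation_code G \<Lambda> y \<longleftrightarrow>
     (\<exists>as. set_listing as \<Lambda> \<and> y = list_val (map pair_val as))"

definition star_partitioning_code :: "nat wgraph \<Rightarrow> (nat set \<Rightarrow> nat) \<Rightarrow> val \<Rightarrow> bool" where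
  "star_partitioning_code G C y \<longleftrightarrow>
     (\<exists>es. set_listing (map edge_of es) (edges G) \<and>
        y = list_val (map (\<lambda>e. Pair (pair_val e) (vertex_val (C (edge_of e)))) es))"

definition W_MinMaxInd :: "(nat wgraph, (nat \<times> nat) set) min_problem" where
  "W_MinMaxInd = \<lparr>is_instance = weighted_simple_graph, feasible = orientation,
     objective = max_in_weight, instance_code = graph_code, solution_code = orientation_code\<rparr>"

definition W_MinMaxStar :: "(nat wgraph, nat set \<Rightarrow> nat) min_problem" where
  "W_MinMaxStar = \<lparr>is_instance = weighted_simple_graph, feasible = star_partitioning,
     objective = max_star_weight, instance_code = graph_code, solution_code = star_partitioning_code\<rparr>"

end

theory Submission
  imports Defs
begin

text \<open>
  Both algorithms use the same greedy orientation.  While vertices remain, take a vertex \<open>v\<close> such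
  that the total weight of its remaining neighbours is least, direct the remaining edges at \<open>v\<close>
  towards \<open>v\<close>, and delete \<open>v\<close>.  The in-weight of \<open>v\<close> is the weighted degree at the moment of its
  deletion.

  Let \<open>R\<close> be the set of remaining vertices at this moment, and let an edge \<open>{u, x}\<close> be worth
  \<open>w u * w x\<close>.  The sum over \<open>x \<in> R\<close> of \<open>w x\<close> times the degree of \<open>x\<close> in \<open>R\<close> counts every edge
  inside \<open>R\<close> twice; for any orientation, the sum over \<open>x \<in> R\<close> of \<open>w x\<close> times the in-weight of \<open>x\<close>
  counts it at least once.  So the least degree is at most twice the largest in-weight of
  any orientation (\<open>min_degree_le\<close>), and the greedy orientation is a 2-approximation (\<open>peel_all\<close>).

  For star partitionings, assign each edge to its tail in the greedy orientation.  The stars at \<open>v\<close>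
  have at most the in-weight of \<open>v\<close> plus, if \<open>v\<close> is a tail, the weight of \<open>v\<close>; the latter is bounded by
  the in-weight of a head (\<open>star_weight_le\<close>).  This is at most four times the optimum for orientations,
  which is at most the optimum for star partitionings (\<open>max_in_weight_le_max_star_weight\<close>).

  To obtain programs with time bounds, the algorithm is written as a function on trees, using only
  operations that preserve computability in polynomial time: the primitive operations, composition,
  case distinction, and folds over lists whose accumulator grows additively (\<open>ptime_foldr\<close>).
  The program itself is never spelled out.  Weights are first multiplied by the product of all
  denominators, so that sums are sums of integers, whose length grows slowly.
\<close>

section \<open>Operations on binary trees and their sizes\<close>

lemma poly_nat_mono:
  fixes P :: "nat poly"
  shows "m \<le> n \<Longrightarrow> poly P m \<le> poly P n"
  by (induction P) (auto intro!: add_mono mult_mono)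

definition vfst :: "val \<Rightarrow> val" where "vfst = apply_prim First"
definition vsnd :: "val \<Rightarrow> val" where "vsnd = apply_prim Second"
definition vadd :: "val \<Rightarrow> val \<Rightarrow> val" where "vadd x y = apply_prim Add (Pair x y)"
definition vmul :: "val \<Rightarrow> val \<Rightarrow> val" where "vmul x y = apply_prim Mul (Pair x y)"
definition vdiv :: "val \<Rightarrow> val \<Rightarrow> val" where "vdiv x y = apply_prim Div (Pair x y)"
definition vle :: "val \<Rightarrow> val \<Rightarrow> bool" where "vle x y \<longleftrightarrow> apply_prim Leq (Pair x y) \<noteq> Num 0"
definition vpair :: "val \<Rightarrow> bool" where "vpair x \<longleftrightarrow> apply_prim IsPair x \<noteq> Num 0"

text \<open>
  Every tree is read as a list, whatever number ends its right spine.  This totality allows time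
  bounds to be proved for all inputs, without any assumption of well-formedness.
\<close>

fun vlist :: "val \<Rightarrow> val list" where
  "vlist (Pair a b) = a # vlist b"
| "vlist (Num i) = []"

lemma vprim_simps [simp]:
  "vfst (Pair a b) = a" "vfst (Num i) = Num 0"
  "vsnd (Pair a b) = b" "vsnd (Num i) = Num 0"
  "vadd (Num i) (Num j) = Num (i + j)"
  "vmul (Num i) (Num j) = Num (i * j)"
  "vdiv (Num i) (Num j) = Num (i div j)"
  "vle (Num i) (Num j) \<longleftrightarrow> i \<le> j"
  "vpair (Pair a b)" "\<not> vpair (Num i)"
  by (auto simp: vfst_def vsnd_def vadd_def vmul_def vdiv_def vle_def vpair_def)

lemma vlist_list_val [simp]: "vlist (list_val xs) = xs"
  by (induction xs) auto

lemma vsize_list_val_vlist: "vsize (list_val (vlist x)) \<le> vsize x"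
  by (induction x) (auto simp: floorlog_def)

lemma less_two_power_floorlog: "n < 2 ^ floorlog 2 n"
  using floorlog_leD[of 2 n "floorlog 2 n"] by auto

lemma vsize_add: "vsize (vadd x y) \<le> vsize x + vsize y + 1"
proof (cases "\<exists>i j. x = Num i \<and> y = Num j")
  case True
  then obtain i j where [simp]: "x = Num i" "y = Num j" by blast
  let ?a = "floorlog 2 (nat \<bar>i\<bar>)" and ?b = "floorlog 2 (nat \<bar>j\<bar>)"
  have "nat \<bar>i + j\<bar> < 2 ^ ?a + 2 ^ ?b"
    using less_two_power_floorlog[of "nat \<bar>i\<bar>"] less_two_power_floorlog[of "nat \<bar>j\<bar>"] by linarith
  also have "\<dots> \<le> 2 ^ (?a + ?b) + (2::nat) ^ (?a + ?b)"
    by (intro add_mono power_increasing) auto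
  also have "\<dots> = 2 ^ (?a + ?b + 1)" by simp
  finally show ?thesis by (auto intro!: floorlog_leI)
next
  case False
  then show ?thesis by (cases x; cases y) (auto simp: vadd_def floorlog_def)
qed

lemma vsize_mul: "vsize (vmul x y) \<le> vsize x + vsize y"
proof (cases "\<exists>i j. x = Num i \<and> y = Num j")
  case True
  then obtain i j where [simp]: "x = Num i" "y = Num j" by blast
  let ?a = "floorlog 2 (nat \<bar>i\<bar>)" and ?b = "floorlog 2 (nat \<bar>j\<bar>)"
  have "nat \<bar>i * j\<bar> < 2 ^ ?a * 2 ^ ?b"
    using mult_strict_mono[OF less_two_power_floorlog[of "nat \<bar>i\<bar>"] less_two_power_floorlog[of "nat \<bar>j\<bar>"]]
    by (simp add: abs_mult nat_mult_distrib)
  then show ?thesis by (auto intro!: floorlog_leI simp: power_add)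
next
  case False
  then show ?thesis by (cases x; cases y) (auto simp: vmul_def floorlog_def)
qed

lemma abs_div_le: "\<bar>i div j\<bar> \<le> \<bar>i::int\<bar>"
proof -
  have *: "\<bar>i div j\<bar> \<le> \<bar>i\<bar>" if "j > 0" for i j :: int
  proof (cases "i \<ge> 0")
    case True
    then show ?thesis using that zdiv_mono2[of i 1 j] by (simp add: pos_imp_zdiv_nonneg_iff)
  next
    case False
    then have "i * j \<le> i" using that by (simp add: mult_le_cancel_left1)
    then have "i * j div j \<le> i div j" using that by (intro zdiv_mono1)
    moreover have "i div j < 0" using False that by (simp add: neg_imp_zdiv_neg_iff div_neg_pos_less0)
    ultimately show ?thesis using that by simp
  qed
  show ?thesis using *[of j i] *[of "- j" "- i"] by (cases j "0 :: int" rule: linorder_cases) auto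
qed

lemma vsize_div: "vsize (vdiv x y) \<le> vsize x"
  using abs_div_le by (cases x; cases y) (auto simp: vdiv_def floorlog_def[of 2 0] intro!: floorlog_mono nat_mono)

text \<open>
  The summand \<^term>\<open>vsize (apply_prim f (Num 0))\<close> is a constant depending on \<^term>\<open>f\<close> only:
  it pays for the constant of \<^const>\<open>Const\<close> and for the default value 0.
\<close>

lemma vsize_prim: "vsize (apply_prim f x) \<le> 2 * vsize x + vsize (apply_prim f (Num 0))"
proof (cases f)
  case Add
  then show ?thesis using vsize_add[of "vfst x" "vsnd x"] by (cases x) (auto simp: vadd_def floorlog_def)
next
  case Mul
  then show ?thesis using vsize_mul[of "vfst x" "vsnd x"] by (cases x) (auto simp: vmul_def floorlog_def)
next
  case Div
  then show ?thesis using vsize_div[of "vfst x" "vsnd x"] by (cases x) (auto simp: vdiv_def floorlog_def)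
next
  case Sub
  have "apply_prim Sub x = (case x of Pair (Num i) (Num j) \<Rightarrow> apply_prim Add (Pair (Num i) (Num (- j))) | _ \<Rightarrow> Num 0)"
    by (auto split: val.split)
  then show ?thesis using Sub vsize_add[of "vfst x" "Num (case vsnd x of Num j \<Rightarrow> - j | _ \<Rightarrow> 0)"]
    by (auto simp: vadd_def floorlog_def split: val.splits)
next
  case Leq
  then show ?thesis by (cases "(Leq, x)" rule: apply_prim.cases) (auto simp: floorlog_def compute_floorlog)
next
  case IsPair
  then show ?thesis by (cases x) (auto simp: floorlog_def compute_floorlog)
qed (cases x; auto simp: floorlog_def)+


section \<open>Functions computable in polynomial time\<close>

text \<open>
  The time bound holds on all inputs, so the closure properties below need no side conditions about
  the shape of intermediate values.  Composition is harmless because a run cannot produce an output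
  larger than its time.
\<close>

definition ptime :: "(val \<Rightarrow> val) \<Rightarrow> bool" where
  "ptime f \<longleftrightarrow> (\<exists>p P. \<forall>x. \<exists>t. run p x (f x) t \<and> t \<le> poly P (vsize x))"

lemma ptimeI:
  assumes "\<And>x. \<exists>t. run p x (f x) t \<and> t \<le> poly P (vsize x)"
  shows "ptime f"
  using assms unfolding ptime_def by blast

lemma ptimeE:
  assumes "ptime f"
  obtains p P where "\<And>x. \<exists>t. run p x (f x) t \<and> t \<le> poly P (vsize x)"
  using assms unfolding ptime_def by blast

lemma ptime_vsize:
  assumes "ptime f"
  obtains P where "\<And>x. vsize (f x) \<le> poly P (vsize x)"
proof -
  obtain p P where *: "\<And>x. \<exists>t. run p x (f x) t \<and> t \<le> poly P (vsize x)"
    using assms by (rule ptimeE) blast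
  have "vsize (f x) \<le> poly P (vsize x)" for x
    using *[of x] vsize_le_time by (meson le_trans)
  then show ?thesis by (rule that)
qed

lemma ptime_apply_prim: "ptime (apply_prim q)"
proof (rule ptimeI)
  fix x
  show "\<exists>t. run (Prim q) x (apply_prim q x) t \<and> t \<le> poly [:vsize (apply_prim q (Num 0)), 3:] (vsize x)"
    using run.Prim[of q x] vsize_prim[of q x] by fastforce
qed

lemma ptime_compose:
  assumes "ptime g" "ptime f"
  shows "ptime (\<lambda>x. g (f x))"
proof -
  from assms(2) obtain p P where f: "\<And>x. \<exists>t. run p x (f x) t \<and> t \<le> poly P (vsize x)"
    by (rule ptimeE) blast
  from assms(1) obtain q Q where g: "\<And>x. \<exists>t. run q x (g x) t \<and> t \<le> poly Q (vsize x)"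
    by (rule ptimeE) blast
  show ?thesis
  proof (rule ptimeI)
    fix x
    obtain s t where s: "run p x (f x) s" "s \<le> poly P (vsize x)"
      and t: "run q (f x) (g (f x)) t" "t \<le> poly Q (vsize (f x))"
      using f g by blast
    have "vsize (f x) \<le> poly P (vsize x)" using s vsize_le_time le_trans by blast
    then have "t \<le> poly Q (poly P (vsize x))" using t(2) poly_nat_mono le_trans by blast
    then show "\<exists>t. run (Seq p q) x (g (f x)) t \<and> t \<le> poly (P + pcompose Q P + 1) (vsize x)"
      using run.Seq[OF s(1) t(1)] s(2) by (intro exI[of _ "s + t + 1"]) (auto simp: poly_pcompose)
  qed
qed

lemma ptime_id: "ptime (\<lambda>x. x)"
  using ptime_apply_prim[of Ident] by (rule back_subst[of ptime]) auto

lemma ptime_const: "ptime (\<lambda>x. Num i)"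
  using ptime_apply_prim[of "Const i"] by (rule back_subst[of ptime]) auto

lemma ptime_Pair:
  assumes "ptime f" "ptime g"
  shows "ptime (\<lambda>x. Pair (f x) (g x))"
proof -
  from assms(1) obtain p P where f: "\<And>x. \<exists>t. run p x (f x) t \<and> t \<le> poly P (vsize x)"
    by (rule ptimeE) blast
  from assms(2) obtain q Q where g: "\<And>x. \<exists>t. run q x (g x) t \<and> t \<le> poly Q (vsize x)"
    by (rule ptimeE) blast
  show ?thesis
  proof (rule ptimeI)
    fix x
    obtain s t where "run p x (f x) s" "s \<le> poly P (vsize x)" "run q x (g x) t" "t \<le> poly Q (vsize x)"
      using f g by blast
    then show "\<exists>t. run (Fork p q) x (Pair (f x) (g x)) t \<and> t \<le> poly (P + Q + 1) (vsize x)"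
      using run.Fork[of p x "f x" s q "g x" t] by (intro exI[of _ "s + t + 1"]) auto
  qed
qed

lemma ptime_prim:
  assumes "ptime f"
  shows "ptime (\<lambda>x. vfst (f x))" "ptime (\<lambda>x. vsnd (f x))"
  using ptime_compose[OF ptime_apply_prim assms] unfolding vfst_def vsnd_def by auto

lemma ptime_arith:
  assumes "ptime f" "ptime g"
  shows "ptime (\<lambda>x. vadd (f x) (g x))" "ptime (\<lambda>x. vmul (f x) (g x))" "ptime (\<lambda>x. vdiv (f x) (g x))"
  using ptime_compose[OF ptime_apply_prim ptime_Pair[OF assms]]
  unfolding vadd_def vmul_def vdiv_def by auto

text \<open>
  A function of several arguments is handled as a function of nested pairs; the next two rules
  translate back.
\<close>

lemma ptime_compose2:
  assumes "ptime (\<lambda>y. f (vfst y) (vsnd y))" "ptime a" "ptime b"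
  shows "ptime (\<lambda>x. f (a x) (b x))"
  using ptime_compose[OF assms(1) ptime_Pair[OF assms(2,3)]] by simp

lemma ptime_compose3:
  assumes "ptime (\<lambda>y. f (vfst y) (vfst (vsnd y)) (vsnd (vsnd y)))" "ptime a" "ptime b" "ptime c"
  shows "ptime (\<lambda>x. f (a x) (b x) (c x))"
  using ptime_compose[OF assms(1) ptime_Pair[OF assms(2) ptime_Pair[OF assms(3,4)]]] by simp

text \<open>
  Conditions are kept as predicates of the logic; the program computes their truth value as 0 or 1.
\<close>

definition ptime_dec :: "(val \<Rightarrow> bool) \<Rightarrow> bool" where
  "ptime_dec b \<longleftrightarrow> ptime (\<lambda>x. Num (of_bool (b x)))"

lemma ptime_if_nonzero:
  assumes "ptime b" "ptime f" "ptime g"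
  shows "ptime (\<lambda>x. if b x \<noteq> Num 0 then f x else g x)"
proof -
  from assms(1) obtain r R where b: "\<And>x. \<exists>t. run r x (b x) t \<and> t \<le> poly R (vsize x)"
    by (rule ptimeE) blast
  from assms(2) obtain p P where f: "\<And>x. \<exists>t. run p x (f x) t \<and> t \<le> poly P (vsize x)"
    by (rule ptimeE) blast
  from assms(3) obtain q Q where g: "\<And>x. \<exists>t. run q x (g x) t \<and> t \<le> poly Q (vsize x)"
    by (rule ptimeE) blast
  show ?thesis
  proof (rule ptimeI)
    fix x
    obtain u s t where u: "run r x (b x) u" "u \<le> poly R (vsize x)"
      and s: "run p x (f x) s" "s \<le> poly P (vsize x)" and t: "run q x (g x) t" "t \<le> poly Q (vsize x)"
      using b f g by blast
    show "\<exists>t. run (Cond r p q) x (if b x \<noteq> Num 0 then f x else g x) t \<and> t \<le> poly (R + P + Q + 1) (vsize x)"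
    proof (cases "b x = Num 0")
      case True
      then show ?thesis using run.CondFalse[of r x u q "g x" t] u s t
        by (intro exI[of _ "u + t + 1"]) auto
    next
      case False
      then show ?thesis using run.CondTrue[of r x "b x" u p "f x" s] u s t
        by (intro exI[of _ "u + s + 1"]) auto
    qed
  qed
qed

lemma ptime_dec_nonzero: "ptime b \<Longrightarrow> ptime_dec (\<lambda>x. b x \<noteq> Num 0)"
  using ptime_if_nonzero[OF _ ptime_const[of 1] ptime_const[of 0], of b]
  unfolding ptime_dec_def of_bool_def by (simp add: if_distrib[of Num])

lemma ptime_if:
  assumes "ptime_dec b" "ptime f" "ptime g"
  shows "ptime (\<lambda>x. if b x then f x else g x)"
  using ptime_if_nonzero[OF assms[unfolded ptime_dec_def]] by (simp cong: if_cong)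

lemma ptime_dec_compose2:
  assumes "ptime_dec (\<lambda>y. b (vfst y) (vsnd y))" "ptime f" "ptime g"
  shows "ptime_dec (\<lambda>x. b (f x) (g x))"
  using ptime_compose2[OF assms(1)[unfolded ptime_dec_def] assms(2,3)] unfolding ptime_dec_def .

lemma ptime_dec_vpair: "ptime f \<Longrightarrow> ptime_dec (\<lambda>x. vpair (f x))"
  unfolding vpair_def by (intro ptime_dec_nonzero ptime_compose[OF ptime_apply_prim])

lemma ptime_dec_vle: "ptime f \<Longrightarrow> ptime g \<Longrightarrow> ptime_dec (\<lambda>x. vle (f x) (g x))"
  unfolding vle_def by (intro ptime_dec_nonzero ptime_compose[OF ptime_apply_prim] ptime_Pair)

lemma ptime_dec_conj:
  assumes "ptime_dec a" "ptime_dec b"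
  shows "ptime_dec (\<lambda>x. a x \<and> b x)"
  using ptime_if[OF assms(1) assms(2)[unfolded ptime_dec_def] ptime_const[of 0]]
  unfolding ptime_dec_def by (rule back_subst[of ptime]) auto

lemma ptime_dec_not:
  assumes "ptime_dec a"
  shows "ptime_dec (\<lambda>x. \<not> a x)"
  using ptime_if[OF assms ptime_const[of 0] ptime_const[of 1]]
  unfolding ptime_dec_def by (rule back_subst[of ptime]) auto

lemma ptime_dec_disj:
  assumes "ptime_dec a" "ptime_dec b"
  shows "ptime_dec (\<lambda>x. a x \<or> b x)"
  using ptime_dec_not[OF ptime_dec_conj[OF assms[THEN ptime_dec_not]]] by simp

lemmas ptime_intros = ptime_id ptime_const ptime_Pair ptime_prim ptime_arith ptime_if
  ptime_dec_vpair ptime_dec_vle ptime_dec_conj ptime_dec_not ptime_dec_disj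

text \<open>
  The loop keeps the pair of the remaining list and the accumulator.  It is run once per list
  element, so its time is polynomial provided that every intermediate accumulator has polynomial
  size.  Polynomial time of \<^term>\<open>g\<close> alone would not suffice: repeated squaring is a fold.
\<close>

lemma ptime_foldl_bounded:
  assumes l: "ptime l" and init: "ptime init" and g: "ptime (\<lambda>y. g (vfst y) (vsnd y))"
    and bound: "\<And>x ys zs. vlist (l x) = ys @ zs \<Longrightarrow> vsize (foldl g (init x) ys) \<le> poly Q (vsize x)"
  shows "ptime (\<lambda>x. foldl g (init x) (vlist (l x)))"
proof -
  from ptime_dec_vpair[OF ptime_prim(1)[OF ptime_id]] obtain r R
    where r: "\<And>x. \<exists>t. run r x (Num (of_bool (vpair (vfst x)))) t \<and> t \<le> poly R (vsize x)"
    unfolding ptime_dec_def by (rule ptimeE) blast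
  have "ptime (\<lambda>y. Pair (vsnd (vfst y)) (g (vsnd y) (vfst (vfst y))))"
    using ptime_compose[OF g, of "\<lambda>y. Pair (vsnd y) (vfst (vfst y))"]
    by (simp add: ptime_intros)
  then obtain b B where b: "\<And>x. \<exists>t. run b x (Pair (vsnd (vfst x)) (g (vsnd x) (vfst (vfst x)))) t
      \<and> t \<le> poly B (vsize x)"
    by (rule ptimeE) blast
  have loop: "\<exists>l' t. run (While r b) (Pair l a) (Pair l' (foldl g a (vlist l))) t
      \<and> t \<le> (length (vlist l) + 1) * (poly R M + poly B M + 1)"
    if "\<And>ys zs. vlist l = ys @ zs \<Longrightarrow> 1 + vsize l + vsize (foldl g a ys) \<le> M" for l a M
    using that
  proof (induction l arbitrary: a)
    case (Num i)
    obtain t where t: "run r (Pair (Num i) a) (Num 0) t" "t \<le> poly R (vsize (Pair (Num i) a))"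
      using r[of "Pair (Num i) a"] by auto
    have "t \<le> poly R M"
      using Num[of "[]" "[]"] t(2) poly_nat_mono[of "vsize (Pair (Num i) a)" M R] by fastforce
    then show ?case using run.WhileFalse[OF t(1)] by fastforce
  next
    case (Pair h l)
    have le: "vsize (Pair (Pair h l) a) \<le> M" using Pair.prems[of "[]"] by simp
    obtain s where s: "run r (Pair (Pair h l) a) (Num 1) s" "s \<le> poly R M"
      using r[of "Pair (Pair h l) a"] poly_nat_mono[OF le, of R] le_trans by fastforce
    obtain u where u: "run b (Pair (Pair h l) a) (Pair l (g a h)) u" "u \<le> poly B M"
      using b[of "Pair (Pair h l) a"] poly_nat_mono[OF le, of B] le_trans by fastforce
    have "\<exists>l' t. run (While r b) (Pair l (g a h)) (Pair l' (foldl g (g a h) (vlist l))) t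
      \<and> t \<le> (length (vlist l) + 1) * (poly R M + poly B M + 1)"
    proof (rule Pair.IH(2))
      fix ys zs assume "vlist l = ys @ zs"
      then show "1 + vsize l + vsize (foldl g (g a h) ys) \<le> M"
        using Pair.prems[of "h # ys" zs] by simp
    qed
    then obtain l' t where t: "run (While r b) (Pair l (g a h)) (Pair l' (foldl g (g a h) (vlist l))) t"
      "t \<le> (length (vlist l) + 1) * (poly R M + poly B M + 1)" by blast
    show ?case
      using run.WhileTrue[OF s(1) _ u(1) t(1)] s(2) u(2) t(2)
      by (intro exI[of _ l'] exI[of _ "s + u + t + 1"]) auto
  qed
  have len: "length (vlist l) \<le> vsize l" for l by (induction l) auto
  obtain L where L: "\<And>x. vsize (l x) \<le> poly L (vsize x)"
    using l by (rule ptime_vsize) blast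
  obtain pre Pre where pre: "\<And>x. \<exists>t. run pre x (Pair (l x) (init x)) t \<and> t \<le> poly Pre (vsize x)"
    by (rule ptimeE[of "\<lambda>x. Pair (l x) (init x)"]) (auto intro!: ptime_intros l init)
  obtain post Post where post: "\<And>x. \<exists>t. run post x (vsnd x) t \<and> t \<le> poly Post (vsize x)"
    by (rule ptimeE[of "\<lambda>x. vsnd x"]) (auto intro!: ptime_intros l init)
  define N where "N = 2 + L + Q"
  define T where "T = (1 + L) * (pcompose R N + pcompose B N + 1)"
  show ?thesis
  proof (rule ptimeI)
    fix x
    obtain s where s: "run pre x (Pair (l x) (init x)) s" "s \<le> poly Pre (vsize x)"
      using pre by blast
    have "\<exists>l' t. run (While r b) (Pair (l x) (init x)) (Pair l' (foldl g (init x) (vlist (l x)))) t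
      \<and> t \<le> (length (vlist (l x)) + 1) * (poly R (poly N (vsize x)) + poly B (poly N (vsize x)) + 1)"
    proof (rule loop)
      fix ys zs assume "vlist (l x) = ys @ zs"
      from bound[OF this] L[of x] show "1 + vsize (l x) + vsize (foldl g (init x) ys) \<le> poly N (vsize x)"
        by (simp add: N_def)
    qed
    then obtain l' t where t: "run (While r b) (Pair (l x) (init x)) (Pair l' (foldl g (init x) (vlist (l x)))) t"
      "t \<le> (length (vlist (l x)) + 1) * (poly R (poly N (vsize x)) + poly B (poly N (vsize x)) + 1)" by blast
    have t_le: "t \<le> poly T (vsize x)"
      using len[of "l x"] L[of x] by (intro le_trans[OF t(2)]) (auto simp: T_def poly_pcompose intro!: add_mono mult_le_mono)
    obtain u where u: "run post (Pair l' (foldl g (init x) (vlist (l x)))) (foldl g (init x) (vlist (l x))) u"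
      "u \<le> poly Post (vsize (Pair l' (foldl g (init x) (vlist (l x)))))"
      using post[of "Pair l' (foldl g (init x) (vlist (l x)))"] by auto
    have "vsize (Pair l' (foldl g (init x) (vlist (l x)))) \<le> poly T (vsize x)"
      using vsize_le_time[OF t(1)] t_le by linarith
    then have "u \<le> poly (pcompose Post T) (vsize x)"
      using u(2) poly_nat_mono le_trans unfolding poly_pcompose by blast
    then show "\<exists>t. run (Seq pre (Seq (While r b) post)) x (foldl g (init x) (vlist (l x))) t
        \<and> t \<le> poly (Pre + (T + pcompose Post T + 1) + 1) (vsize x)"
      using run.Seq[OF s(1) run.Seq[OF t(1) u(1)]] s(2) t_le
      by (intro exI[of _ "s + (t + u + 1) + 1"]) simp
  qed
qed


text \<open>
  A fold is harmless if a step enlarges the accumulator \<^emph>\<open>additively\<close>, by an amount that does not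
  depend on the accumulator.  The input \<^term>\<open>x\<close> remains available to the step function, because
  the program carries it along in the accumulator.
\<close>

lemma ptime_foldl:
  assumes l: "ptime l" and init: "ptime init"
    and g: "ptime (\<lambda>y. g (vfst y) (vfst (vsnd y)) (vsnd (vsnd y)))"
    and growth: "\<And>x h a. vsize (g x h a) \<le> vsize a + poly K (vsize x + vsize h)"
  shows "ptime (\<lambda>x. foldl (\<lambda>a h. g x h a) (init x) (vlist (l x)))"
proof -
  define g' where "g' s h = Pair (vfst s) (g (vfst s) h (vsnd s))" for s h
  have fold_g': "foldl g' (Pair x a) hs = Pair x (foldl (\<lambda>a h. g x h a) a hs)" for x a hs
    by (induction hs arbitrary: a) (auto simp: g'_def)
  obtain L where L: "\<And>x. vsize (l x) \<le> poly L (vsize x)"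
    using l by (rule ptime_vsize) blast
  obtain I where I: "\<And>x. vsize (init x) \<le> poly I (vsize x)"
    using init by (rule ptime_vsize) blast
  define Q where "Q = [:1, 1:] + I + L * pcompose K ([:0, 1:] + L)"
  have "ptime (\<lambda>y. g' (vfst y) (vsnd y))"
    unfolding g'_def by (intro ptime_intros ptime_compose3[OF g])
  moreover have "vsize (foldl g' (Pair x (init x)) ys) \<le> poly Q (vsize x)"
    if l_x: "vlist (l x) = ys @ zs" for x ys zs
  proof -
    have "vsize (foldl (\<lambda>a h. g x h a) a ys) \<le> vsize a + length ys * poly K (vsize x + vsize (l x))"
      if "\<forall>h\<in>set ys. vsize h \<le> vsize (l x)" for a
      using that
    proof (induction ys arbitrary: a)
      case (Cons h ys)
      have "vsize (g x h a) \<le> vsize a + poly K (vsize x + vsize (l x))"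
        using Cons.prems by (intro le_trans[OF growth]) (auto intro!: poly_nat_mono)
      then show ?case using Cons.IH[of "g x h a"] Cons.prems by simp
    qed simp
    moreover have "h \<in> set (vlist v) \<Longrightarrow> vsize h \<le> vsize v" for h v
      by (induction v) auto
    moreover have "length ys \<le> poly L (vsize x)"
    proof -
      have "length (vlist v) \<le> vsize v" for v by (induction v) auto
      from le_trans[OF this L] show ?thesis using l_x by (metis add_leD1 length_append)
    qed
    ultimately have "vsize (foldl (\<lambda>a h. g x h a) (init x) ys)
        \<le> vsize (init x) + length ys * poly K (vsize x + vsize (l x))"
      using l_x by (metis Un_iff set_append)
    also have "\<dots> \<le> poly I (vsize x) + poly L (vsize x) * poly K (vsize x + poly L (vsize x))"
      using I L \<open>length ys \<le> _\<close> by (intro add_mono mult_le_mono poly_nat_mono) auto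
    finally show ?thesis by (simp add: fold_g' Q_def poly_pcompose)
  qed
  ultimately have "ptime (\<lambda>x. foldl g' (Pair x (init x)) (vlist (l x)))"
    by (intro ptime_foldl_bounded l ptime_intros init) auto
  then have "ptime (\<lambda>x. vsnd (foldl g' (Pair x (init x)) (vlist (l x))))"
    by (rule ptime_prim)
  then show ?thesis by (simp add: fold_g')
qed

lemma ptime_rev:
  assumes "ptime l"
  shows "ptime (\<lambda>x. list_val (rev (vlist (l x))))"
proof -
  have "foldl (\<lambda>a h. Pair h a) (list_val as) hs = list_val (rev hs @ as)" for as hs
    by (induction hs arbitrary: as) (auto simp flip: list_val.simps)
  from this[of "[]"] have "list_val (rev hs) = foldl (\<lambda>a h. Pair h a) (Num 0) hs" for hs
    by simp
  moreover have "ptime (\<lambda>x. foldl (\<lambda>a h. Pair h a) (Num 0) (vlist (l x)))"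
    by (rule ptime_foldl[where g = "\<lambda>x h a. Pair h a" and K = "[:1, 1:]"]) (auto intro!: ptime_intros assms)
  ultimately show ?thesis by simp
qed

lemma ptime_foldr:
  assumes "ptime l" "ptime init"
    and "ptime (\<lambda>y. g (vfst y) (vfst (vsnd y)) (vsnd (vsnd y)))"
    and "\<And>x h a. vsize (g x h a) \<le> vsize a + poly K (vsize x + vsize h)"
  shows "ptime (\<lambda>x. foldr (g x) (vlist (l x)) (init x))"
  using ptime_foldl[OF ptime_rev[OF assms(1)] assms(2-4)] by (simp add: foldl_conv_foldr)

lemma ptime_map:
  assumes "ptime l" "ptime (\<lambda>y. f (vfst y) (vsnd y))"
  shows "ptime (\<lambda>x. list_val (map (f x) (vlist (l x))))"
proof -
  obtain F where "\<And>y. vsize (f (vfst y) (vsnd y)) \<le> poly F (vsize y)"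
    using assms(2) by (rule ptime_vsize) blast
  from this[of "Pair x h" for x h] have "vsize (f x h) \<le> poly F (1 + vsize x + vsize h)" for x h
    by simp
  then have "ptime (\<lambda>x. foldr (\<lambda>h a. Pair (f x h) a) (vlist (l x)) (Num 0))"
    by (intro ptime_foldr[where g = "\<lambda>x h a. Pair (f x h) a" and K = "1 + pcompose F [:1, 1:]"])
      (auto intro!: ptime_intros ptime_compose2[OF assms(2)] assms(1) simp: poly_pcompose add.assoc)
  moreover have "list_val (map g hs) = foldr (\<lambda>h a. Pair (g h) a) hs (Num 0)" for g :: "val \<Rightarrow> val" and hs
    by (induction hs) auto
  ultimately show ?thesis by simp
qed

lemma ptime_filter:
  assumes "ptime l" "ptime_dec (\<lambda>y. P (vfst y) (vsnd y))"
  shows "ptime (\<lambda>x. list_val (filter (P x) (vlist (l x))))"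
proof -
  have "ptime (\<lambda>x. foldr (\<lambda>h a. if P x h then Pair h a else a) (vlist (l x)) (Num 0))"
    by (intro ptime_foldr[where g = "\<lambda>x h a. if P x h then Pair h a else a" and K = "[:1, 1:]"])
      (auto intro!: ptime_intros ptime_dec_compose2[OF assms(2)] assms(1))
  moreover have "foldr (\<lambda>h a. if Q h then Pair h a else a) hs (Num 0) = list_val (filter Q hs)" for Q hs
    by (induction hs) auto
  ultimately show ?thesis by simp
qed

definition vsum :: "(val \<Rightarrow> val) \<Rightarrow> val list \<Rightarrow> val" where
  "vsum f hs = foldr (\<lambda>h a. vadd (f h) a) hs (Num 0)"

lemma ptime_vsum:
  assumes "ptime l" "ptime (\<lambda>y. f (vfst y) (vsnd y))"
  shows "ptime (\<lambda>x. vsum (f x) (vlist (l x)))"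
proof -
  obtain F where "\<And>y. vsize (f (vfst y) (vsnd y)) \<le> poly F (vsize y)"
    using assms(2) by (rule ptime_vsize) blast
  from this[of "Pair x h" for x h] have F: "vsize (f x h) \<le> poly F (1 + vsize x + vsize h)" for x h
    by simp
  have "vsize (vadd (f x h) a) \<le> vsize a + poly (1 + pcompose F [:1, 1:]) (vsize x + vsize h)" for x h a
    using vsize_add[of "f x h" a] F[of x h] by (simp add: poly_pcompose add.assoc)
  then show ?thesis unfolding vsum_def
    by (intro ptime_foldr[where g = "\<lambda>x h a. vadd (f x h) a"] ptime_intros ptime_compose2[OF assms(2)] assms(1))
qed

section \<open>Removing a vertex of least weighted degree\<close>

lemma weighted_simple_graphD:
  assumes "weighted_simple_graph G"
  shows "finite (verts G)" "{u, v} \<in> edges G \<Longrightarrow> u \<in> verts G \<and> v \<in> verts G \<and> u \<noteq> v"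
    "v \<in> verts G \<Longrightarrow> 0 < weight G v" "finite (edges G)"
proof -
  have "edges G \<subseteq> Pow (verts G)" using assms by (auto simp: weighted_simple_graph_def)
  then show "finite (edges G)" using assms by (auto simp: weighted_simple_graph_def intro: finite_subset)
next
  assume "{u, v} \<in> edges G"
  then have "{u, v} \<subseteq> verts G \<and> card {u, v} = 2" using assms by (auto simp: weighted_simple_graph_def)
  then show "u \<in> verts G \<and> v \<in> verts G \<and> u \<noteq> v" by (auto simp: card_insert_if split: if_splits)
qed (use assms in \<open>auto simp: weighted_simple_graph_def\<close>)

lemma in_weight_le_max:
  "weighted_simple_graph G \<Longrightarrow> v \<in> verts G \<Longrightarrow> in_weight G \<Lambda> v \<le> max_in_weight G \<Lambda>"
  unfolding max_in_weight_def by (intro Max_ge) (auto dest: weighted_simple_graphD(1))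

lemma orientation_of_star_partitioning:
  assumes "weighted_simple_graph G" "star_partitioning G C"
  shows "orientation G {(u, v). {u, v} \<in> edges G \<and> C {u, v} = u}"
  using assms weighted_simple_graphD(2)[OF assms(1)]
  unfolding orientation_def star_partitioning_def by (fastforce simp: insert_commute)

text \<open>
  This averaging argument is the source of the factor 2.  Give the edge between \<^term>\<open>u\<close> and
  \<^term>\<open>x\<close> the value \<^term>\<open>weight G u * weight G x\<close>.  Then the weighted degrees inside \<^term>\<open>R\<close>,
  multiplied by the weights of their vertices, add up to twice the value of all edges of \<^term>\<open>F\<close>
  inside \<^term>\<open>R\<close>, each edge being counted at both ends.  The in-weights of an arbitrary
  orientation count it at its head only.  Hence the least degree is at most twice the
  weighted average of the in-weights.
\<close>

lemma min_degree_le: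
  assumes G: "weighted_simple_graph G" and "orientation G \<Lambda>" and B: "\<And>x. x \<in> R \<Longrightarrow> in_weight G \<Lambda> x \<le> B"
    and R: "R \<subseteq> verts G" and F: "F \<subseteq> edges G"
    and "v \<in> R" and v_min: "\<And>x. x \<in> R \<Longrightarrow>
      (\<Sum>u\<in>{u \<in> R. {u, v} \<in> F}. weight G u) \<le> (\<Sum>u\<in>{u \<in> R. {u, x} \<in> F}. weight G u)"
  shows "(\<Sum>u\<in>{u \<in> R. {u, v} \<in> F}. weight G u) \<le> 2 * B"
proof -
  define w where "w = weight G"
  define deg where "deg x = (\<Sum>u\<in>{u \<in> R. {u, x} \<in> F}. w u)" for x
  have fin: "finite R" using G R weighted_simple_graphD(1) finite_subset by blast
  have pos: "0 < w x" if "x \<in> R" for x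
    using weighted_simple_graphD(3)[OF G] R that by (auto simp: w_def)
  define a where "a u x = (if {u, x} \<in> F \<and> (u, x) \<in> \<Lambda> then w u * w x else 0)" for u x
  have split: "(if {u, x} \<in> F then w u * w x else 0) = a u x + a x u" for u x
  proof (cases "{u, x} \<in> F")
    case True
    then have "(u, x) \<in> \<Lambda> \<longleftrightarrow> (x, u) \<notin> \<Lambda>"
      using F \<open>orientation G \<Lambda>\<close> unfolding orientation_def by blast
    then show ?thesis using True by (auto simp: a_def insert_commute)
  qed (auto simp: a_def insert_commute)
  \<comment> \<open>Sum over ordered pairs, so that both ends of an edge are counted without choosing an end.\<close>
  have "deg v * (\<Sum>x\<in>R. w x) \<le> (\<Sum>x\<in>R. deg x * w x)"
    unfolding sum_distrib_left using v_min pos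
    by (intro sum_mono mult_right_mono) (auto simp: deg_def w_def less_imp_le)
  also have "\<dots> = (\<Sum>x\<in>R. \<Sum>u\<in>R. if {u, x} \<in> F then w u * w x else 0)"
    unfolding deg_def using fin
    by (intro sum.cong refl) (auto simp: sum_distrib_right sum.inter_filter intro!: sum.cong)
  also have "\<dots> = (\<Sum>x\<in>R. \<Sum>u\<in>R. a u x) + (\<Sum>x\<in>R. \<Sum>u\<in>R. a x u)"
    unfolding split by (simp add: sum.distrib)
  also have "(\<Sum>x\<in>R. \<Sum>u\<in>R. a x u) = (\<Sum>x\<in>R. \<Sum>u\<in>R. a u x)"
    by (rule sum.swap)
  also have "(\<Sum>x\<in>R. \<Sum>u\<in>R. a u x) \<le> (\<Sum>x\<in>R. B * w x)"
  proof (rule sum_mono)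
    fix x assume "x \<in> R"
    have "(\<Sum>u\<in>R. a u x) \<le> (\<Sum>u\<in>R. if (u, x) \<in> \<Lambda> then w u * w x else 0)"
      using pos \<open>x \<in> R\<close> by (intro sum_mono) (auto simp: a_def less_imp_le)
    also have "\<dots> = (\<Sum>u\<in>{u \<in> R. (u, x) \<in> \<Lambda>}. w u) * w x"
      using fin by (auto simp: sum_distrib_right sum.inter_filter intro!: sum.cong)
    also have "\<dots> \<le> in_weight G \<Lambda> x * w x"
      unfolding in_weight_def w_def
      using R weighted_simple_graphD(1,3)[OF G] \<open>x \<in> R\<close>
      by (intro mult_right_mono sum_mono2) (auto simp: less_imp_le)
    also have "\<dots> \<le> B * w x"
      using B pos \<open>x \<in> R\<close> by (intro mult_right_mono) (auto simp: less_imp_le)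
    finally show "(\<Sum>u\<in>R. a u x) \<le> B * w x" .
  qed
  finally have "deg v * (\<Sum>x\<in>R. w x) \<le> (2 * B) * (\<Sum>x\<in>R. w x)"
    by (simp add: sum_distrib_left mult.assoc)
  moreover have "0 < (\<Sum>x\<in>R. w x)"
    using fin \<open>v \<in> R\<close> pos by (intro sum_pos) auto
  ultimately show ?thesis by (simp add: deg_def w_def)
qed

section \<open>The peeling algorithm on lists\<close>

definition arg_min_foldr :: "('a \<Rightarrow> 'b::linorder) \<Rightarrow> 'a list \<Rightarrow> 'a \<Rightarrow> 'a" where
  "arg_min_foldr f = foldr (\<lambda>r a. if f a \<le> f r then a else r)"

lemma arg_min_foldr: "arg_min_foldr f xs a \<in> set (a # xs)"
  "x \<in> set (a # xs) \<Longrightarrow> f (arg_min_foldr f xs a) \<le> f x"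
  unfolding arg_min_foldr_def by (induction xs) auto

definition joins :: "'a \<times> 'a \<Rightarrow> 'a \<Rightarrow> 'a \<Rightarrow> bool" where
  "joins e u v \<longleftrightarrow> e = (u, v) \<or> e = (v, u)"

definition touches :: "'a \<times> 'a \<Rightarrow> 'a \<Rightarrow> bool" where
  "touches e v \<longleftrightarrow> fst e = v \<or> snd e = v"

text \<open>
  Meant for edges \<^term>\<open>e\<close> that touch \<^term>\<open>v\<close>: the arc ends in \<^term>\<open>v\<close>.
\<close>

definition towards :: "'a \<Rightarrow> 'a \<times> 'a \<Rightarrow> 'a \<times> 'a" where
  "towards v e = (if snd e = v then e else (snd e, fst e))"

text \<open>
  The weighted degree of \<^term>\<open>v\<close>.  As a double sum it needs no table of weights: the weights
  are stored with the vertices that remain, and no other vertex has an edge left.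
\<close>

definition load :: "('a \<Rightarrow> int) \<Rightarrow> 'a list \<Rightarrow> ('a \<times> 'a) list \<Rightarrow> 'a \<Rightarrow> int" where
  "load W R E v = (\<Sum>u\<leftarrow>R. \<Sum>e\<leftarrow>E. if joins e u v then W u else 0)"

definition pick :: "('a \<Rightarrow> int) \<Rightarrow> 'a list \<Rightarrow> ('a \<times> 'a) list \<Rightarrow> 'a" where
  "pick W R E = arg_min_foldr (load W R E) R (hd R)"

text \<open>
  The state consists of the remaining vertices, the edges not yet directed, and the arcs.  Nothing is done
  once all vertices are gone, since \<^const>\<open>pick\<close> is meaningful for nonempty lists only.
\<close>

definition peel :: "('a \<Rightarrow> int) \<Rightarrow> 'a list \<times> ('a \<times> 'a) list \<times> ('a \<times> 'a) list \<Rightarrow>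
    'a list \<times> ('a \<times> 'a) list \<times> ('a \<times> 'a) list" where
  "peel W = (\<lambda>(R, E, A). if R = [] then (R, E, A) else let v = pick W R E in
     (filter (\<lambda>u. u \<noteq> v) R, filter (\<lambda>e. \<not> touches e v) E,
      map (towards v) (filter (\<lambda>e. touches e v) E) @ A))"

lemma edge_of_joins: "joins e u v \<longleftrightarrow> edge_of e = {u, v}"
  by (cases e) (auto simp: joins_def edge_of_def doubleton_eq_iff)

lemma edge_of_touches: "touches e v \<longleftrightarrow> v \<in> edge_of e"
  by (cases e) (auto simp: touches_def edge_of_def)

lemma edge_of_towards: "touches e v \<Longrightarrow> edge_of (towards v e) = edge_of e"
  by (cases e) (auto simp: touches_def edge_of_def towards_def)

lemma snd_towards: "touches e v \<Longrightarrow> snd (towards v e) = v"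
  by (cases e) (auto simp: touches_def towards_def)

lemma load_eq:
  assumes "distinct R" "distinct (map edge_of E)"
  shows "load W R E v = (\<Sum>u\<in>{u \<in> set R. {u, v} \<in> edge_of ` set E}. W u)"
proof -
  have "(\<Sum>e\<leftarrow>E. if joins e u v then W u else 0) = (if {u, v} \<in> edge_of ` set E then W u else 0)" for u
    using assms(2) unfolding edge_of_joins by (induction E) auto
  then show ?thesis
    using assms(1) by (simp add: load_def sum_list_distinct_conv_sum_set sum.inter_filter)
qed

text \<open>
  The vertices still present receive arcs later, the others never again; so the in-weight of a vertex
  is settled when it is removed.
\<close>

definition peel_inv :: "'a wgraph \<Rightarrow> rat \<Rightarrow> 'a list \<times> ('a \<times> 'a) list \<times> ('a \<times> 'a) list \<Rightarrow> bool" where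
  "peel_inv G B = (\<lambda>(R, E, A). distinct R \<and> set R \<subseteq> verts G \<and>
     distinct (map edge_of (E @ A)) \<and> edge_of ` set (E @ A) = edges G \<and>
     (\<forall>e\<in>set E. edge_of e \<subseteq> set R) \<and> (\<forall>e\<in>set A. snd e \<notin> set R) \<and>
     (\<forall>v\<in>verts G. in_weight G (set A) v \<le> 2 * B))"

text \<open>
  The weights \<^term>\<open>W\<close> of the program are integers: the true weights multiplied by a common
  denominator \<^term>\<open>D\<close>, which does not change the choice of the vertex.
\<close>

lemma peel_inv_peel:
  assumes G: "weighted_simple_graph G" and \<Lambda>: "orientation G \<Lambda>"
    and W: "\<And>u. u \<in> verts G \<Longrightarrow> of_int (W u) = D * weight G u" and "0 < D"
    and inv: "peel_inv G (max_in_weight G \<Lambda>) (R, E, A)" and "R \<noteq> []"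
  shows "peel_inv G (max_in_weight G \<Lambda>) (peel W (R, E, A))"
    and "length (fst (peel W (R, E, A))) < length R"
proof -
  define v where "v = pick W R E"
  have R: "distinct R" "set R \<subseteq> verts G"
    and EA: "distinct (map edge_of (E @ A))" "edge_of ` set (E @ A) = edges G"
    and E: "\<And>e. e \<in> set E \<Longrightarrow> edge_of e \<subseteq> set R" and A: "\<And>e. e \<in> set A \<Longrightarrow> snd e \<notin> set R"
    and le: "\<And>v. v \<in> verts G \<Longrightarrow> in_weight G (set A) v \<le> 2 * max_in_weight G \<Lambda>"
    using inv by (auto simp: peel_inv_def)
  have set_hd: "set (hd R # R) = set R" using \<open>R \<noteq> []\<close> by (cases R) auto
  have v: "v \<in> set R"
    using arg_min_foldr(1)[of "load W R E" R "hd R"] unfolding set_hd v_def pick_def .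
  have load: "of_int (load W R E x) = D * (\<Sum>u\<in>{u \<in> set R. {u, x} \<in> edge_of ` set E}. weight G u)" for x
  proof -
    have "distinct (map edge_of E)" using EA by simp
    then show ?thesis
      using R W by (auto simp: load_eq sum_distrib_left intro!: sum.cong)
  qed
  have deg_v: "(\<Sum>u\<in>{u \<in> set R. {u, v} \<in> edge_of ` set E}. weight G u) \<le> 2 * max_in_weight G \<Lambda>"
  proof (rule min_degree_le[OF G \<Lambda>])
    fix x assume "x \<in> set R"
    then have "load W R E v \<le> load W R E x"
      using arg_min_foldr(2)[of x "hd R" R "load W R E"] unfolding set_hd v_def pick_def by blast
    then have "of_int (load W R E v) \<le> (of_int (load W R E x) :: rat)" by simp
    then show "(\<Sum>u\<in>{u \<in> set R. {u, v} \<in> edge_of ` set E}. weight G u)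
        \<le> (\<Sum>u\<in>{u \<in> set R. {u, x} \<in> edge_of ` set E}. weight G u)"
      unfolding load using \<open>0 < D\<close> by simp
  next
    fix x assume "x \<in> set R"
    then show "in_weight G \<Lambda> x \<le> max_in_weight G \<Lambda>"
      using in_weight_le_max[OF G] R by auto
  qed (use R EA v in auto)
  define T where "T = filter (\<lambda>e. touches e v) E"
  define E' where "E' = filter (\<lambda>e. \<not> touches e v) E"
  define A' where "A' = map (towards v) T @ A"
  have peel: "peel W (R, E, A) = (filter (\<lambda>u. u \<noteq> v) R, E', A')"
    using \<open>R \<noteq> []\<close> by (simp add: peel_def v_def Let_def T_def E'_def A'_def)
  have map_towards: "map edge_of (map (towards v) T) = map edge_of T"
    by (auto simp: T_def edge_of_towards)
  have "mset (filter P es) + mset (filter (\<lambda>e. \<not> P e) es) = mset es" for P and es :: "('a \<times> 'a) list"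
    by (induction es) auto
  then have "mset E = mset E' + mset T" by (simp add: T_def E'_def add.commute)
  moreover have "map edge_of A' = map edge_of T @ map edge_of A"
    unfolding A'_def map_append map_towards ..
  ultimately have "mset (map edge_of (E' @ A')) = mset (map edge_of (E @ A))"
    by simp
  then have EA': "distinct (map edge_of (E' @ A'))" "edge_of ` set (E' @ A') = edges G"
    using EA mset_eq_imp_distinct_iff mset_eq_setD by (metis, metis list.set_map)
  have in_weight: "in_weight G (set A') x \<le> 2 * max_in_weight G \<Lambda>" if x: "x \<in> verts G" for x
  proof (cases "x = v")
    case False
    have "snd a = v" if "a \<in> set (map (towards v) T)" for a
      using that by (auto simp: T_def snd_towards)
    then have "(u, x) \<in> set A' \<longleftrightarrow> (u, x) \<in> set A" for u
      using False unfolding A'_def by fastforce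
    then show ?thesis using le[OF x] by (simp add: in_weight_def)
  next
    case True
    have "u \<in> set R \<and> {u, v} \<in> edge_of ` set E" if "(u, v) \<in> set A'" for u
    proof -
      have "(u, v) \<notin> set A" using A v by fastforce
      then have "(u, v) \<in> towards v ` set T" using that by (simp add: A'_def)
      then obtain e where e: "e \<in> set E" "touches e v" "(u, v) = towards v e"
        unfolding T_def set_filter by blast
      then have "edge_of e = {u, v}" using edge_of_towards[of e v] by (simp add: edge_of_def flip: e(3))
      then show ?thesis using e(1) E by (metis image_eqI insert_subset)
    qed
    then have "in_weight G (set A') v \<le> (\<Sum>u\<in>{u \<in> set R. {u, v} \<in> edge_of ` set E}. weight G u)"
      unfolding in_weight_def using less_imp_le[OF weighted_simple_graphD(3)[OF G]] R
      by (intro sum_mono2) auto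
    then show ?thesis using deg_v True by simp
  qed
  show "peel_inv G (max_in_weight G \<Lambda>) (peel W (R, E, A))"
    unfolding peel peel_inv_def prod.case
  proof (intro conjI ballI)
    show "edge_of e \<subseteq> set (filter (\<lambda>u. u \<noteq> v) R)" if "e \<in> set E'" for e
      using that E[of e] by (auto simp: E'_def edge_of_touches)
    show "snd e \<notin> set (filter (\<lambda>u. u \<noteq> v) R)" if "e \<in> set A'" for e
      using that A[of e] by (auto simp: A'_def T_def snd_towards)
  qed (use R EA' in_weight in auto)
  show "length (fst (peel W (R, E, A))) < length R"
    unfolding peel using v by (auto intro: length_filter_less)
qed

definition peel_all :: "('a \<Rightarrow> int) \<Rightarrow> 'a list \<Rightarrow> ('a \<times> 'a) list \<Rightarrow> ('a \<times> 'a) list" where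
  "peel_all W vs es = snd (snd ((peel W ^^ length vs) (vs, es, [])))"

text \<open>
  The orientation is found without looking at \<^term>\<open>\<Lambda>\<close>, so the bound holds for all \<^term>\<open>\<Lambda>\<close> at once.
\<close>

lemma peel_all:
  assumes G: "weighted_simple_graph G"
    and W: "\<And>u. u \<in> verts G \<Longrightarrow> of_int (W u) = D * weight G u" "0 < D"
    and vs: "set_listing vs (verts G)" and es: "set_listing (map edge_of es) (edges G)"
  shows "set_listing (map edge_of (peel_all W vs es)) (edges G)"
    and "distinct (peel_all W vs es)"
    and "orientation G (set (peel_all W vs es))"
    and "\<And>\<Lambda> v. orientation G \<Lambda> \<Longrightarrow> v \<in> verts G \<Longrightarrow>
      in_weight G (set (peel_all W vs es)) v \<le> 2 * max_in_weight G \<Lambda>"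
proof -
  have inv: "peel_inv G (max_in_weight G \<Lambda>) ((peel W ^^ k) (vs, es, [])) \<and>
      length (fst ((peel W ^^ k) (vs, es, []))) \<le> length vs - k" if \<Lambda>: "orientation G \<Lambda>" "k \<le> length vs" for \<Lambda> k
    using that(2)
  proof (induction k)
    case 0
    have "edge_of e \<subseteq> verts G" if "e \<in> set es" for e
    proof -
      have "edge_of e \<in> edges G" using es that by (auto simp: set_listing_def)
      then show ?thesis using G by (auto simp: weighted_simple_graph_def)
    qed
    moreover have "0 \<le> max_in_weight G \<Lambda>"
      unfolding max_in_weight_def using weighted_simple_graphD(1)[OF G] by (intro Max_ge) auto
    ultimately show ?case
      using vs es by (auto simp: peel_inv_def set_listing_def in_weight_def)
  next
    case (Suc k)
    obtain R E A where s: "(peel W ^^ k) (vs, es, []) = (R, E, A)" by (metis prod_cases3)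
    show ?case
    proof (cases "R = []")
      case False
      then show ?thesis
        using Suc peel_inv_peel[OF G \<Lambda>(1) W, of R E A] unfolding funpow.simps comp_def s by fastforce
    next
      case True
      then have "peel W (R, E, A) = (R, E, A)" by (simp add: peel_def)
      then show ?thesis using Suc True by (simp add: s)
    qed
  qed
  obtain R E A where s: "(peel W ^^ length vs) (vs, es, []) = (R, E, A)" by (metis prod_cases3)
  then have A: "peel_all W vs es = A" by (simp add: peel_all_def)
  have final: "E = [] \<and> distinct (map edge_of A) \<and> edge_of ` set A = edges G \<and>
     (\<forall>v\<in>verts G. in_weight G (set A) v \<le> 2 * max_in_weight G \<Lambda>)" if "orientation G \<Lambda>" for \<Lambda>
  proof -
    have "R = []" "peel_inv G (max_in_weight G \<Lambda>) (R, E, A)" using inv[OF that, of "length vs"] s by auto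
    moreover from this have "E = []" by (cases E) (auto simp: peel_inv_def edge_of_def)
    ultimately show ?thesis by (auto simp: peel_inv_def)
  qed
  \<comment> \<open>The facts about the final state were derived from some orientation; one exists.\<close>
  have "star_partitioning G (\<lambda>e. SOME u. u \<in> e)"
    unfolding star_partitioning_def
  proof
    fix e assume "e \<in> edges G"
    then have "e \<noteq> {}" using G by (auto simp: weighted_simple_graph_def)
    then show "(SOME u. u \<in> e) \<in> e" by (simp add: some_in_eq)
  qed
  from orientation_of_star_partitioning[OF G this] obtain \<Lambda> where "orientation G \<Lambda>" ..
  from final[OF this] have dist: "distinct (map edge_of A)" and A_edges: "edge_of ` set A = edges G" by auto
  then show "set_listing (map edge_of (peel_all W vs es)) (edges G)" "distinct (peel_all W vs es)"
    by (auto simp: A set_listing_def distinct_map)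
  show "orientation G (set (peel_all W vs es))"
    unfolding orientation_def A
  proof (intro conjI ballI allI impI)
    fix e assume "e \<in> set A"
    then show "case e of (u, v) \<Rightarrow> {u, v} \<in> edges G" using A_edges by (auto simp: edge_of_def)
  next
    fix u v assume uv: "{u, v} \<in> edges G"
    then obtain e where "e \<in> set A" "edge_of e = {u, v}" using A_edges by (metis imageE)
    moreover have "\<not> ((u, v) \<in> set A \<and> (v, u) \<in> set A)"
      using dist weighted_simple_graphD(2)[OF G uv]
      by (auto simp: distinct_map inj_on_def edge_of_def insert_commute)
    ultimately show "(u, v) \<in> set A \<longleftrightarrow> (v, u) \<notin> set A"
      by (auto simp: edge_of_def doubleton_eq_iff split: prod.splits)
  qed
  show "in_weight G (set (peel_all W vs es)) v \<le> 2 * max_in_weight G \<Lambda>"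
    if "orientation G \<Lambda>" "v \<in> verts G" for \<Lambda> v
    using final[OF that(1)] that(2) by (simp add: A)
qed

section \<open>The peeling algorithm on trees\<close>

definition veq :: "val \<Rightarrow> val \<Rightarrow> bool" where
  "veq x y \<longleftrightarrow> vle x y \<and> vle y x"

definition vjoins :: "val \<Rightarrow> val \<Rightarrow> val \<Rightarrow> bool" where
  "vjoins e u v \<longleftrightarrow> veq (vfst e) u \<and> veq (vsnd e) v \<or> veq (vfst e) v \<and> veq (vsnd e) u"

text \<open>
  The test \<^const>\<open>vpair\<close> ensures that redirecting an edge never enlarges it, even if the list of
  edges contains numbers; \<open>vsize_vpeel\<close> relies on it.
\<close>

definition vtouches :: "val \<Rightarrow> val \<Rightarrow> bool" where
  "vtouches e v \<longleftrightarrow> vpair e \<and> (veq (vfst e) v \<or> veq (vsnd e) v)"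

definition vtowards :: "val \<Rightarrow> val \<Rightarrow> val" where
  "vtowards v e = (if veq (vsnd e) v then e else Pair (vsnd e) (vfst e))"

definition vload :: "val \<Rightarrow> val \<Rightarrow> val \<Rightarrow> val" where
  "vload R E r = vsum (\<lambda>q. vsum (\<lambda>e. if vjoins e (vfst q) (vfst r) then vsnd q else Num 0)
     (vlist E)) (vlist R)"

definition vpick :: "val \<Rightarrow> val \<Rightarrow> val" where
  "vpick R E = foldr (\<lambda>r a. if vle (vload R E a) (vload R E r) then a else r) (vlist R) (vfst R)"

definition vdirect :: "val \<Rightarrow> val \<Rightarrow> val \<Rightarrow> val" where
  "vdirect v E A = foldr (\<lambda>e a. if vtouches e v then Pair (vtowards v e) a else a) (vlist E) A"

definition vremove :: "val \<Rightarrow> val \<Rightarrow> val \<Rightarrow> val \<Rightarrow> val" where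
  "vremove v R E A = Pair (list_val (filter (\<lambda>r. \<not> veq (vfst r) v) (vlist R)))
     (Pair (list_val (filter (\<lambda>e. \<not> vtouches e v) (vlist E))) (vdirect v E A))"

definition vpeel :: "val \<Rightarrow> val" where
  "vpeel s = (if vpair (vfst s)
     then vremove (vfst (vpick (vfst s) (vfst (vsnd s)))) (vfst s) (vfst (vsnd s)) (vsnd (vsnd s))
     else s)"

text \<open>
  The product of the denominators serves as the common denominator: unlike for a running sum of
  fractions, all numbers then grow additively in length.
\<close>

definition vdenom :: "val \<Rightarrow> val" where
  "vdenom V = foldr (\<lambda>h a. vmul (vsnd (vsnd h)) a) (vlist V) (Num 1)"

definition vscale :: "val \<Rightarrow> val" where
  "vscale V = list_val (map (\<lambda>h. Pair (vfst h)
     (vmul (vfst (vsnd h)) (vdiv (vdenom V) (vsnd (vsnd h))))) (vlist V))"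

text \<open>
  The list of vertices serves as the counter of the rounds, so the loop ends on every input.
\<close>

definition vpeel_all :: "val \<Rightarrow> val" where
  "vpeel_all x = vsnd (vsnd (foldr (\<lambda>_. vpeel) (vlist (vfst x))
     (Pair (vscale (vfst x)) (Pair (vsnd x) (Num 0)))))"

definition vstars :: "val \<Rightarrow> val" where
  "vstars x = list_val (map (\<lambda>e. Pair e (vfst e)) (vlist (vpeel_all x)))"

lemma ptime_dec_veq: "ptime f \<Longrightarrow> ptime g \<Longrightarrow> ptime_dec (\<lambda>x. veq (f x) (g x))"
  unfolding veq_def by (intro ptime_intros)

lemma ptime_vload: "ptime R \<Longrightarrow> ptime E \<Longrightarrow> ptime r \<Longrightarrow> ptime (\<lambda>x. vload (R x) (E x) (r x))"
  by (rule ptime_compose3[where f = vload]) (unfold vload_def vjoins_def, intro ptime_vsum ptime_intros ptime_dec_veq)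

lemma vsize_vsnd: "vsize (vsnd x) \<le> vsize x"
  by (cases x) (auto simp: floorlog_def)

lemma ptime_vpick: "ptime R \<Longrightarrow> ptime E \<Longrightarrow> ptime (\<lambda>x. vpick (R x) (E x))"
proof (rule ptime_compose2[where f = vpick])
  show "ptime (\<lambda>y. vpick (vfst y) (vsnd y))"
    unfolding vpick_def
    by (rule ptime_foldr[where K = "[:0, 1:]"], (intro ptime_intros ptime_vload)+) auto
qed

lemma ptime_dec_vtouches: "ptime e \<Longrightarrow> ptime v \<Longrightarrow> ptime_dec (\<lambda>x. vtouches (e x) (v x))"
  unfolding vtouches_def by (intro ptime_intros ptime_dec_veq)

lemma ptime_vtowards: "ptime v \<Longrightarrow> ptime e \<Longrightarrow> ptime (\<lambda>x. vtowards (v x) (e x))"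
  unfolding vtowards_def by (intro ptime_intros ptime_dec_veq)

lemma ptime_vdirect: "ptime v \<Longrightarrow> ptime E \<Longrightarrow> ptime A \<Longrightarrow> ptime (\<lambda>x. vdirect (v x) (E x) (A x))"
proof (rule ptime_compose3[where f = vdirect])
  have "vsize (if vtouches e (vfst y) then Pair (vtowards (vfst y) e) a else a)
      \<le> vsize a + poly [:3, 1:] (vsize y + vsize e)" for y e a
  proof -
    have "vsize (vtowards (vfst y) e) \<le> 2 + vsize e"
      by (cases e) (auto simp: vtowards_def floorlog_def)
    then show ?thesis by auto
  qed
  then show "ptime (\<lambda>y. vdirect (vfst y) (vfst (vsnd y)) (vsnd (vsnd y)))"
    unfolding vdirect_def
    by (intro ptime_foldr[where K = "[:3, 1:]"] ptime_intros ptime_dec_vtouches ptime_vtowards)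
qed

lemma ptime_vremove:
  "ptime v \<Longrightarrow> ptime R \<Longrightarrow> ptime E \<Longrightarrow> ptime A \<Longrightarrow> ptime (\<lambda>x. vremove (v x) (R x) (E x) (A x))"
  unfolding vremove_def
  by (intro ptime_filter ptime_intros ptime_vdirect ptime_dec_veq ptime_dec_vtouches ptime_compose[of _ vfst])

lemma ptime_vpeel: "ptime vpeel"
  unfolding vpeel_def[abs_def] by (intro ptime_intros ptime_vremove ptime_vpick)

text \<open>
  One round moves edges from one list to another and deletes vertices, which costs no space; the
  constant only pays for the missing components of a malformed state.  Thus the rounds satisfy the
  growth condition of \<open>ptime_foldr\<close>, although the new arcs are taken from the state and not from the input.
\<close>

lemma vsize_vpeel: "vsize (vpeel s) \<le> vsize s + 5"
proof -
  define v where "v = vfst (vpick (vfst s) (vfst (vsnd s)))"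
  have flt: "vsize (list_val (filter P xs)) \<le> vsize (list_val xs)" for P xs
    by (induction xs) auto
  have swap: "vsize (vtowards v e) \<le> vsize e" if "vtouches e v" for e
    using that by (cases e) (auto simp: vtowards_def vtouches_def)
  have part: "vsize (list_val (filter (\<lambda>e. \<not> vtouches e v) es)) +
      vsize (foldr (\<lambda>e a. if vtouches e v then Pair (vtowards v e) a else a) es A)
      \<le> vsize (list_val es) + vsize A" for es A
  proof (induction es)
    case (Cons e es)
    then show ?case using swap[of e] by (cases "vtouches e v") simp_all
  qed simp
  have "vsize (vremove v R E A) \<le> vsize R + vsize E + vsize A + 2" for R E A
    using flt[of "\<lambda>r. \<not> veq (vfst r) v" "vlist R"] vsize_list_val_vlist[of R]
      part[of "vlist E" A] vsize_list_val_vlist[of E]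
    unfolding vremove_def vdirect_def vsize.simps by linarith
  from this[of "vfst s" "vfst (vsnd s)" "vsnd (vsnd s)"]
  show ?thesis
    by (cases s; cases "vsnd s") (auto simp: vpeel_def v_def floorlog_def)
qed

lemma ptime_vdenom: "ptime V \<Longrightarrow> ptime (\<lambda>x. vdenom (V x))"
proof (rule ptime_compose[where g = vdenom])
  have "vsize (vmul (vsnd (vsnd h)) a) \<le> vsize a + vsize h" for h a
    using vsize_mul[of "vsnd (vsnd h)" a] vsize_vsnd[of h] vsize_vsnd[of "vsnd h"] by linarith
  then have "vsize (vmul (vsnd (vsnd h)) a) \<le> vsize a + poly [:0, 1:] (vsize V + vsize h)" for V h a
    by (simp add: trans_le_add2 add.left_commute)
  then show "ptime vdenom"
    unfolding vdenom_def[abs_def]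
    by (intro ptime_foldr[where K = "[:0, 1:]"] ptime_intros)
qed

lemma ptime_vscale: "ptime V \<Longrightarrow> ptime (\<lambda>x. vscale (V x))"
  by (rule ptime_compose[where g = vscale])
    (unfold vscale_def[abs_def], intro ptime_map ptime_intros ptime_vdenom)

lemma ptime_vpeel_all: "ptime vpeel_all"
  unfolding vpeel_all_def[abs_def]
  by (intro ptime_prim ptime_foldr[where K = "[:5:]"] ptime_intros ptime_vscale ptime_compose[OF ptime_vpeel])
    (use vsize_vpeel in auto)

lemma ptime_vstars: "ptime vstars"
  unfolding vstars_def[abs_def] by (intro ptime_map ptime_intros ptime_vpeel_all)

section \<open>Correctness of the program\<close>

definition entry_val :: "(nat \<Rightarrow> int) \<Rightarrow> nat \<Rightarrow> val" where
  "entry_val W u = Pair (vertex_val u) (Num (W u))"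

definition state_val :: "(nat \<Rightarrow> int) \<Rightarrow> nat list \<times> (nat \<times> nat) list \<times> (nat \<times> nat) list \<Rightarrow> val" where
  "state_val W = (\<lambda>(R, E, A). Pair (list_val (map (entry_val W) R))
     (Pair (list_val (map pair_val E)) (list_val (map pair_val A))))"

lemma entry_val_simps [simp]: "vfst (entry_val W u) = vertex_val u" "vsnd (entry_val W u) = Num (W u)"
  by (simp_all add: entry_val_def)

lemma pair_val_simps [simp]: "vfst (pair_val e) = vertex_val (fst e)" "vsnd (pair_val e) = vertex_val (snd e)"
  "vpair (pair_val e)"
  by (simp_all add: pair_val_def split: prod.split)

lemma veq_vertex_val [simp]: "veq (vertex_val u) (vertex_val v) \<longleftrightarrow> u = v"
  by (auto simp: veq_def vertex_val_def)

lemma val_simps [simp]: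
  "vjoins (pair_val e) (vertex_val u) (vertex_val v) \<longleftrightarrow> joins e u v"
  "vtouches (pair_val e) (vertex_val v) \<longleftrightarrow> touches e v"
  "vtowards (vertex_val v) (pair_val e) = pair_val (towards v e)"
  by (cases e; auto simp: vjoins_def joins_def vtouches_def touches_def vtowards_def towards_def pair_val_def)+

lemma vsum_map:
  assumes "\<And>h. h \<in> set xs \<Longrightarrow> f (g h) = Num (i h)"
  shows "vsum f (map g xs) = Num (\<Sum>h\<leftarrow>xs. i h)"
  using assms by (induction xs) (auto simp: vsum_def)

lemma vload_val:
  "vload (list_val (map (entry_val W) R)) (list_val (map pair_val E)) (entry_val W v) = Num (load W R E v)"
  unfolding load_def vload_def by (simp add: vsum_map)

lemma vpick_val:
  assumes "R \<noteq> []"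
  shows "vpick (list_val (map (entry_val W) R)) (list_val (map pair_val E)) = entry_val W (pick W R E)"
proof -
  let ?R = "list_val (map (entry_val W) R)" and ?E = "list_val (map pair_val E)"
  have fold: "foldr (\<lambda>r a. if vle (vload ?R ?E a) (vload ?R ?E r) then a else r) (map (entry_val W) xs) (entry_val W a)
    = entry_val W (arg_min_foldr (load W R E) xs a)" for xs a
    by (induction xs) (simp_all add: vload_val arg_min_foldr_def)
  have hd: "vfst ?R = entry_val W (hd R)" using assms by (cases R) auto
  show ?thesis unfolding vpick_def pick_def vlist_list_val hd fold ..
qed

lemma vpeel_val: "vpeel (state_val W s) = state_val W (peel W s)"
proof -
  obtain R E A where s: "s = (R, E, A)" by (metis prod_cases3)
  show ?thesis
  proof (cases "R = []")
    case False
    define v where "v = pick W R E"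
    have "foldr (\<lambda>e a. if vtouches e (vertex_val v) then Pair (vtowards (vertex_val v) e) a else a)
        (map pair_val es) (list_val (map pair_val A))
      = list_val (map pair_val (map (towards v) (filter (\<lambda>e. touches e v) es) @ A))" for es
      by (induction es) auto
    moreover have "vpair (list_val (map (entry_val W) R))" using False by (cases R) auto
    ultimately show ?thesis using False
      by (simp add: s state_val_def vpeel_def vpick_val peel_def vremove_def vdirect_def filter_map comp_def Let_def
          flip: v_def)
  qed (simp add: s state_val_def peel_def vpeel_def)
qed

lemma vpeel_all_val:
  assumes G: "weighted_simple_graph G" and x: "graph_code G x"
  obtains as where "vpeel_all x = list_val (map pair_val as)"
    "set_listing (map edge_of as) (edges G)" "distinct as" "orientation G (set as)"
    "\<And>\<Lambda> v. orientation G \<Lambda> \<Longrightarrow> v \<in> verts G \<Longrightarrow> in_weight G (set as) v \<le> 2 * max_in_weight G \<Lambda>"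
proof -
  obtain vs es where vs: "set_listing vs (verts G)" and es: "set_listing (map edge_of es) (edges G)"
    and x_eq: "x = Pair (list_val (map (\<lambda>v. Pair (vertex_val v) (rat_val (weight G v))) vs))
                 (list_val (map pair_val es))"
    using x by (auto simp: graph_code_def)
  define num den where "num v = fst (quotient_of (weight G v))" and "den v = snd (quotient_of (weight G v))" for v
  have rat: "rat_val (weight G v) = Pair (Num (num v)) (Num (den v))" for v
    by (simp add: rat_val_def num_def den_def split: prod.split)
  define D where "D = (\<Prod>v\<leftarrow>vs. den v)"
  define W where "W v = num v * (D div den v)" for v
  let ?V = "list_val (map (\<lambda>v. Pair (vertex_val v) (rat_val (weight G v))) vs)"
  have "foldr (\<lambda>h a. vmul (vsnd (vsnd h)) a) (map (\<lambda>v. Pair (vertex_val v) (rat_val (weight G v))) us) (Num 1)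
    = Num (\<Prod>v\<leftarrow>us. den v)" for us
    by (induction us) (auto simp: rat)
  then have "vdenom ?V = Num D"
    by (simp add: vdenom_def D_def)
  then have scale: "vscale ?V = list_val (map (entry_val W) vs)"
    by (simp add: vscale_def comp_def rat W_def[abs_def] entry_val_def[abs_def])
  have den_pos: "0 < den v" for v by (simp add: den_def quotient_of_denom_pos')
  then have "0 < D" unfolding D_def by (induction vs) auto
  have W: "of_int (W v) = of_int D * weight G v" if "v \<in> verts G" for v
  proof -
    have "v \<in> set vs" using vs that by (auto simp: set_listing_def)
    then have "den v dvd D" unfolding D_def by (induction vs) auto
    then have "of_int (D div den v) = (of_int D / of_int (den v) :: rat)"
      using den_pos[of v] by (auto simp: dvd_def)
    moreover have "weight G v = of_int (num v) / of_int (den v)"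
      by (intro quotient_of_div) (simp add: num_def den_def)
    ultimately show ?thesis by (simp add: W_def)
  qed
  have "foldr (\<lambda>_. vpeel) us (state_val W s) = state_val W ((peel W ^^ length us) s)" for us :: "val list" and s
    by (induction us) (auto simp: vpeel_val)
  from this[of "vlist ?V" "(vs, es, [])"] have "vpeel_all x = list_val (map pair_val (peel_all W vs es))"
    by (simp add: vpeel_all_def x_eq scale peel_all_def state_val_def split: prod.split)
  moreover note peel_all[OF G W _ vs es]
  ultimately show ?thesis using \<open>0 < D\<close> by (intro that) auto
qed

section \<open>Approximation guarantees\<close>

lemma polytime_approximation_algorithmI:
  assumes "ptime f"
    and finite: "\<And>I. is_instance \<Pi> I \<Longrightarrow> finite {objective \<Pi> I S |S. feasible \<Pi> I S}"
    and approx: "\<And>I x. is_instance \<Pi> I \<Longrightarrow> instance_code \<Pi> I x \<Longrightarrow>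
      \<exists>S. solution_code \<Pi> I S (f x) \<and> feasible \<Pi> I S \<and>
        (\<forall>S'. feasible \<Pi> I S' \<longrightarrow> objective \<Pi> I S \<le> \<alpha> * objective \<Pi> I S')"
  shows "\<exists>p. polytime_approximation_algorithm \<alpha> \<Pi> p"
proof -
  obtain p P where p: "\<And>x. \<exists>t. run p x (f x) t \<and> t \<le> poly P (vsize x)"
    using assms(1) by (rule ptimeE) blast
  have "approximation_algorithm \<alpha> \<Pi> p"
    unfolding approximation_algorithm_def
  proof (intro allI impI)
    fix I x assume I: "is_instance \<Pi> I" and x: "instance_code \<Pi> I x"
    from approx[OF I x] obtain S where S: "solution_code \<Pi> I S (f x)" "feasible \<Pi> I S"
      and le: "\<And>S'. feasible \<Pi> I S' \<Longrightarrow> objective \<Pi> I S \<le> \<alpha> * objective \<Pi> I S'" by blast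
    have "optimal_value \<Pi> I \<in> {objective \<Pi> I S |S. feasible \<Pi> I S}"
      unfolding optimal_value_def using finite[OF I] S by (intro Min_in) auto
    then have "objective \<Pi> I S \<le> \<alpha> * optimal_value \<Pi> I" using le by auto
    then show "\<exists>y t S. run p x y t \<and> solution_code \<Pi> I S y \<and> feasible \<Pi> I S \<and>
        objective \<Pi> I S \<le> \<alpha> * optimal_value \<Pi> I"
      using p[of x] S by blast
  qed
  moreover have "polynomial_time_on (instance_codes \<Pi>) p"
    unfolding polynomial_time_on_def using p by blast
  ultimately show ?thesis unfolding polytime_approximation_algorithm_def by blast
qed

text \<open>
  There may be infinitely many feasible solutions: star partitionings are functions on all sets,
  with arbitrary values outside the set of edges.  All objective values, however, are 0 or weights of vertex sets.
\<close>

lemma finite_objective_values: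
  assumes "finite V" "\<And>S v. f S v \<in> sum w ` Pow V"
  shows "finite {Max (insert (0::rat) (f S ` V)) |S. P S}"
proof (rule finite_subset)
  show "{Max (insert 0 (f S ` V)) |S. P S} \<subseteq> insert 0 (sum w ` Pow V)"
  proof clarify
    fix S assume *: "Max (insert 0 (f S ` V)) \<notin> sum w ` Pow V"
    have "Max (insert 0 (f S ` V)) \<in> insert 0 (f S ` V)"
      using assms(1) by (intro Max_in) auto
    then show "Max (insert 0 (f S ` V)) = 0" using * assms(2) by auto
  qed
qed (use assms(1) in auto)

text \<open>
  Assign every edge to the tail of its arc.  Then the stars at \<^term>\<open>v\<close> are those of its
  in-neighbours and possibly its own.  If \<^term>\<open>v\<close> has a star of its own, it is the tail of an
  arc, and its weight is part of the in-weight of the head of that arc.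
\<close>

lemma star_weight_le:
  assumes G: "weighted_simple_graph G" and "v \<in> verts G"
    and as: "edge_of ` set as = edges G" and C: "\<And>e. e \<in> set as \<Longrightarrow> C (edge_of e) = fst e"
    and le: "\<And>v. v \<in> verts G \<Longrightarrow> in_weight G (set as) v \<le> B" and "0 \<le> B"
  shows "star_weight G C v \<le> 2 * B"
proof -
  have fin: "finite (verts G)" and pos: "\<And>u. u \<in> verts G \<Longrightarrow> 0 < weight G u"
    using weighted_simple_graphD[OF G] by auto
  let ?S = "{u \<in> verts G. \<exists>e\<in>star G C u. v \<in> e}" and ?I = "{u \<in> verts G. (u, v) \<in> set as}"
  have S: "u = v \<and> (\<exists>y. (v, y) \<in> set as) \<or> u \<in> ?I" if u: "u \<in> ?S" for u
  proof -
    obtain e where "e \<in> edges G" "C e = u" "v \<in> e" using u unfolding star_def by blast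
    then have "e \<in> edge_of ` set as" unfolding as by simp
    then obtain x y where xy: "(x, y) \<in> set as" "edge_of (x, y) = e" by (metis imageE surj_pair)
    then have "x = u" using C[OF xy(1)] \<open>C e = u\<close> by simp
    moreover have "v = x \<or> v = y" using xy(2) \<open>v \<in> e\<close> by (auto simp: edge_of_def)
    moreover have "u \<in> verts G" using u by simp
    ultimately show ?thesis using xy(1) by auto
  qed
  show ?thesis
  proof (cases "\<exists>y. (v, y) \<in> set as")
    case True
    then obtain y where y: "(v, y) \<in> set as" by blast
    then have "edge_of (v, y) \<in> edges G" unfolding as[symmetric] by (rule imageI)
    then have "{v, y} \<in> edges G" by (simp add: edge_of_def)
    then have "y \<in> verts G" using weighted_simple_graphD(2)[OF G] by blast
    have "weight G v \<le> in_weight G (set as) y"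
      unfolding in_weight_def using y \<open>v \<in> verts G\<close> fin
      by (intro member_le_sum) (auto intro: less_imp_le[OF pos])
    then have "weight G v \<le> B" using le[OF \<open>y \<in> verts G\<close>] by simp
    have "star_weight G C v \<le> sum (weight G) (insert v ?I)"
      unfolding star_weight_def using S fin pos \<open>v \<in> verts G\<close>
      by (intro sum_mono2) (auto intro: less_imp_le)
    also have "\<dots> \<le> weight G v + in_weight G (set as) v"
      using fin pos[OF \<open>v \<in> verts G\<close>] by (auto simp: in_weight_def sum.insert_if)
    also have "\<dots> \<le> 2 * B" using \<open>weight G v \<le> B\<close> le[OF \<open>v \<in> verts G\<close>] by simp
    finally show ?thesis .
  next
    case False
    then have "star_weight G C v \<le> in_weight G (set as) v"
      unfolding star_weight_def in_weight_def using S fin pos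
      by (intro sum_mono2) (auto intro: less_imp_le)
    then show ?thesis using le[OF \<open>v \<in> verts G\<close>] \<open>0 \<le> B\<close> by simp
  qed
qed

text \<open>
  Conversely, directing each edge away from the centre of its star shows that an optimal star
  partitioning is no cheaper than an optimal orientation.
\<close>

lemma max_in_weight_le_max_star_weight:
  assumes G: "weighted_simple_graph G" and "star_partitioning G C"
  shows "max_in_weight G {(u, v). {u, v} \<in> edges G \<and> C {u, v} = u} \<le> max_star_weight G C"
proof -
  have fin: "finite (verts G)" and pos: "\<And>u. u \<in> verts G \<Longrightarrow> 0 < weight G u"
    using weighted_simple_graphD[OF G] by auto
  have "in_weight G {(u, v). {u, v} \<in> edges G \<and> C {u, v} = u} v \<le> star_weight G C v" for v
    unfolding in_weight_def star_weight_def using fin pos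
    by (intro sum_mono2) (auto simp: star_def intro: less_imp_le)
  moreover have "star_weight G C v \<le> max_star_weight G C" if "v \<in> verts G" for v
    unfolding max_star_weight_def using fin that by (intro Max_ge) auto
  moreover have "0 \<le> max_star_weight G C"
    unfolding max_star_weight_def using fin by (intro Max_ge) auto
  ultimately show ?thesis
    unfolding max_in_weight_def using fin by (subst Max_le_iff) (auto intro: order_trans)
qed

theorem mainTheorem7:
  shows "(\<exists>p. polytime_approximation_algorithm 2 W_MinMaxInd p) \<and>
         (\<exists>p. polytime_approximation_algorithm 4 W_MinMaxStar p)"
proof
  show "\<exists>p. polytime_approximation_algorithm 2 W_MinMaxInd p"
  proof (rule polytime_approximation_algorithmI[OF ptime_vpeel_all], unfold W_MinMaxInd_def min_problem.simps)
    fix G :: "nat wgraph" assume G: "weighted_simple_graph G"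
    show "finite {max_in_weight G \<Lambda> |\<Lambda>. orientation G \<Lambda>}"
      unfolding max_in_weight_def
      by (rule finite_objective_values[where w = "weight G"])
        (use weighted_simple_graphD(1)[OF G] in \<open>auto simp: in_weight_def\<close>)
    fix x assume x: "graph_code G x"
    obtain as where y: "vpeel_all x = list_val (map pair_val as)"
      and as_edges: "set_listing (map edge_of as) (edges G)"
      and dist: "distinct as" and as: "orientation G (set as)"
      and le: "\<And>\<Lambda> v. orientation G \<Lambda> \<Longrightarrow> v \<in> verts G \<Longrightarrow> in_weight G (set as) v \<le> 2 * max_in_weight G \<Lambda>"
      by (rule vpeel_all_val[OF G x]) (rule that)
    have "max_in_weight G (set as) \<le> 2 * max_in_weight G \<Lambda>" if "orientation G \<Lambda>" for \<Lambda>
    proof -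
      have "0 \<le> max_in_weight G \<Lambda>"
        unfolding max_in_weight_def using weighted_simple_graphD(1)[OF G] by (intro Max_ge) auto
      then show ?thesis
        unfolding max_in_weight_def[of G "set as"]
        using weighted_simple_graphD(1)[OF G] le[OF that] by (subst Max_le_iff) auto
    qed
    then show "\<exists>\<Lambda>. orientation_code G \<Lambda> (vpeel_all x) \<and> orientation G \<Lambda> \<and>
        (\<forall>\<Lambda>'. orientation G \<Lambda>' \<longrightarrow> max_in_weight G \<Lambda> \<le> 2 * max_in_weight G \<Lambda>')"
      using y dist as unfolding orientation_code_def set_listing_def by blast
  qed
  show "\<exists>p. polytime_approximation_algorithm 4 W_MinMaxStar p"
  proof (rule polytime_approximation_algorithmI[OF ptime_vstars], unfold W_MinMaxStar_def min_problem.simps)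
    fix G :: "nat wgraph" assume G: "weighted_simple_graph G"
    show "finite {max_star_weight G C |C. star_partitioning G C}"
      unfolding max_star_weight_def
      by (rule finite_objective_values[where w = "weight G"])
        (use weighted_simple_graphD(1)[OF G] in \<open>auto simp: star_weight_def\<close>)
    fix x assume x: "graph_code G x"
    obtain as where y: "vpeel_all x = list_val (map pair_val as)"
      and as: "set_listing (map edge_of as) (edges G)"
      and dist: "distinct as" and "orientation G (set as)"
      and le: "\<And>\<Lambda> v. orientation G \<Lambda> \<Longrightarrow> v \<in> verts G \<Longrightarrow> in_weight G (set as) v \<le> 2 * max_in_weight G \<Lambda>"
      by (rule vpeel_all_val[OF G x]) (rule that)
    have as_edges: "edge_of ` set as = edges G" using as by (auto simp: set_listing_def)
    define C where "C e = fst (inv_into (set as) edge_of e)" for e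
    have "inj_on edge_of (set as)" using as by (auto simp: set_listing_def distinct_map)
    then have C: "C (edge_of e) = fst e" if "e \<in> set as" for e using that by (simp add: C_def)
    have "star_partitioning G C"
      unfolding star_partitioning_def
    proof
      fix e assume "e \<in> edges G"
      then have "e \<in> edge_of ` set as" unfolding as_edges .
      then obtain u v where "(u, v) \<in> set as" "e = edge_of (u, v)" by (metis imageE surj_pair)
      then show "C e \<in> e" using C[of "(u, v)"] by (simp add: edge_of_def)
    qed
    moreover have "star_partitioning_code G C (vstars x)"
    proof -
      have "vstars x = list_val (map (\<lambda>e. Pair (pair_val e) (vertex_val (C (edge_of e)))) as)"
        using C by (auto simp: vstars_def y comp_def intro!: arg_cong[where f = list_val])
      then show ?thesis using as unfolding star_partitioning_code_def by blast
    qed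
    moreover have "max_star_weight G C \<le> 4 * max_star_weight G C'" if C': "star_partitioning G C'" for C'
    proof -
      let ?B = "2 * max_star_weight G C'"
      have "0 \<le> max_star_weight G C'"
        unfolding max_star_weight_def using weighted_simple_graphD(1)[OF G] by (intro Max_ge) auto
      moreover have "in_weight G (set as) v \<le> ?B" if "v \<in> verts G" for v
        using le[OF orientation_of_star_partitioning[OF G C'] that] max_in_weight_le_max_star_weight[OF G C'] by simp
      ultimately have "star_weight G C v \<le> 2 * ?B" if "v \<in> verts G" for v
        using that by (intro star_weight_le[OF G _ as_edges C]) auto
      then show ?thesis
        unfolding max_star_weight_def[of G C]
        using weighted_simple_graphD(1)[OF G] \<open>0 \<le> max_star_weight G C'\<close> by (subst Max_le_iff) auto
    qed
    ultimately show "\<exists>C. star_partitioning_code G C (vstars x) \<and> star_partitioning G C \<and>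
        (\<forall>C'. star_partitioning G C' \<longrightarrow> max_star_weight G C \<le> 4 * max_star_weight G C')"
      by blast
  qed
qed

end
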